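(* Let $(P,r)$ be a finite graded poset, and suppose that $\varDelta(P)$ is a triangulation of a homology $n$-manifold $X$. Then for $0\le k\le n$, $$H_i(\varDelta^{(k)}(P))\cong H_i(X)\qquad (i\le k-1),$$ $$n-k\le \beta_k(\varDelta^{(k)}(P))\le \#\{(x,y)\in P\times P\mid x\le y,\ r(y)-r(x)=k\},$$ where $\beta_k$ denotes the $k$-th Betti number.
   Context: All homology is with integer coefficients. A topological space $X$ is a homology $n$-manifold (without boundary) if for every $x\in X$ the local homology $H_i(X,X\setminus\{x\})$ is $0$ for $i\ne n$ and is isomorphic to $\mathbb{Z}$ for $i=n$. A finite poset $P$ is graded of rank $m\ge 0$ if every maximal chain of $P$ has length $m$ (i.e. $m+1$ elements); its rank function $r$ satisfies $r(x)=0$ for $x$ minimal and $r(y)=r(x)+1$ if $y$ covers $x$. The order complex $\varDelta(P)$ is the abstract simplicial complex whose simplices are the chains of $P$, and $\varDelta^{(k)}(P)=\{(x_0<\cdots<x_l)\mid r(x_l)-r(x_0)\le k\}\subseteq\varDelta(P)$. *)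

theory Defs
  imports "HOL-Homology.Homology" "HOL-Library.Extended_Nat"
begin

definition covers_in :: "'a::order set \<Rightarrow> 'a \<Rightarrow> 'a \<Rightarrow> bool"
  where "covers_in P y x \<longleftrightarrow> x \<in> P \<and> y \<in> P \<and> x < y \<and> \<not> (\<exists>z\<in>P. x < z \<and> z < y)"

definition minimal_in :: "'a::order set \<Rightarrow> 'a \<Rightarrow> bool"
  where "minimal_in P x \<longleftrightarrow> x \<in> P \<and> \<not> (\<exists>y\<in>P. y < x)"

text \<open>
  A chain of length \<open>m\<close> has \<open>m + 1\<close> elements. In particular the empty poset, whose only maximal
  chain is empty, is not graded. The rank function \<open>r\<close> is only relevant on \<open>P\<close>.
\<close>

definition finite_graded_poset :: "'a::order set \<Rightarrow> nat \<Rightarrow> ('a \<Rightarrow> nat) \<Rightarrow> bool"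
  where "finite_graded_poset P m r \<longleftrightarrow>
    finite P \<and>
    (\<forall>C. pred_on.maxchain P (\<le>) C \<longrightarrow> card C = m + 1) \<and>
    (\<forall>x. minimal_in P x \<longrightarrow> r x = 0) \<and>
    (\<forall>x y. covers_in P y x \<longrightarrow> r y = r x + 1)"

text \<open>Abstract simplicial complexes are represented by their sets of nonempty simplices.\<close>

definition order_complex :: "'a::order set \<Rightarrow> 'a set set"
  where "order_complex P = {C. pred_on.chain P (\<le>) C \<and> finite C \<and> C \<noteq> {}}"

text \<open>
  The elements \<open>a\<close> and \<open>b\<close> below are the endpoints \<open>x\<^sub>0\<close> and \<open>x\<^sub>l\<close> of a chain
  \<open>x\<^sub>0 < \<dots> < x\<^sub>l\<close>.
\<close>

definition rank_order_complex :: "'a::order set \<Rightarrow> ('a \<Rightarrow> nat) \<Rightarrow> nat \<Rightarrow> 'a set set"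
  where "rank_order_complex P r k =
    {C \<in> order_complex P.
       \<exists>a\<in>C. \<exists>b\<in>C. (\<forall>z\<in>C. a \<le> z \<and> z \<le> b) \<and> int (r b) - int (r a) \<le> int k}"

text \<open>
  Points are given by their barycentric coordinates. The topology of pointwise convergence of
  the coordinates is the usual (weak) topology whenever the complex is finite.
\<close>

definition geometric_realization :: "'a set set \<Rightarrow> ('a \<Rightarrow> real) topology"
  where "geometric_realization K = subtopology (powertop_real UNIV)
    {f. (\<forall>v. 0 \<le> f v) \<and> {v. f v \<noteq> 0} \<in> K \<and> (\<Sum>v | f v \<noteq> 0. f v) = 1}"

definition homology_manifold :: "nat \<Rightarrow> 'a topology \<Rightarrow> bool"
  where "homology_manifold n X \<longleftrightarrow>
    (\<forall>x \<in> topspace X. \<forall>i::int.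
       (i \<noteq> int n \<longrightarrow> trivial_group (relative_homology_group i X (topspace X - {x}))) \<and>
       (i = int n \<longrightarrow> relative_homology_group i X (topspace X - {x}) \<cong> integer_group))"

definition independent_in :: "('a, 'b) monoid_scheme \<Rightarrow> 'a set \<Rightarrow> bool"
  where "independent_in G B \<longleftrightarrow> finite B \<and> B \<subseteq> carrier G \<and>
    (\<forall>c :: 'a \<Rightarrow> int. (\<Otimes>\<^bsub>G\<^esub>b\<in>B. b [^]\<^bsub>G\<^esub> c b) = \<one>\<^bsub>G\<^esub> \<longrightarrow> (\<forall>b\<in>B. c b = 0))"

text \<open>
  The rank of an abelian group (written multiplicatively) is the maximal number of elements that
  are linearly independent over the integers; it may be infinite, hence the extended naturals.
\<close>

definition abelian_group_rank :: "('a, 'b) monoid_scheme \<Rightarrow> enat"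
  where "abelian_group_rank G = (SUP B \<in> {B. independent_in G B}. enat (card B))"

definition betti_number :: "nat \<Rightarrow> 'a topology \<Rightarrow> enat"
  where "betti_number k X = abelian_group_rank (homology_group (int k) X)"

end

theory Submission
  imports Defs
begin

text \<open>
  Let \<open>\<sigma>\<close> consist of \<open>x\<close>, \<open>y\<close> and the elements outside \<open>[x, y]\<close> of a maximal chain through
  \<open>x \<le> y\<close>. The star of \<open>\<sigma>\<close> in \<open>\<Delta>(P)\<close> is the join of \<open>\<sigma>\<close> with the link \<open>\<Delta>(x, y)\<close>. Dropping the
  vertices of \<open>\<sigma>\<close> other than \<open>x\<close> and \<open>y\<close> one at a time shifts degrees by one each time, so the
  local homology of the manifold at \<open>\<sigma>\<close> shows that the homology of \<open>\<Delta>[x, y]\<close> relative to the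
  chains not containing both endpoints is \<open>\<int>\<close>, concentrated in degree \<open>r(y) - r(x)\<close>.

  Hence adding intervals one at a time (smaller ones first) builds \<open>\<Delta>(P)\<close> like a CW complex
  with one cell of dimension \<open>r(y) - r(x)\<close> for each interval, and \<open>\<Delta>\<^sup>(\<^sup>k\<^sup>)(P)\<close> is its \<open>k\<close>-skeleton.
  This gives the isomorphisms below degree \<open>k\<close> and the upper bound.

  For the lower bound choose a maximal chain with elements \<open>e\<^sub>j\<close> of rank \<open>j\<close>. The boundary of the
  cell \<open>[e\<^sub>j, e\<^sub>j\<^sub>+\<^sub>k\<^sub>+\<^sub>1]\<close> is a class that cannot vanish on all \<open>k\<close>-cells \<open>[e\<^sub>j, w]\<close>, because
  otherwise it would come from the cone of chains in that interval avoiding \<open>e\<^sub>j\<close>. As later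
  classes do not involve \<open>e\<^sub>j\<close> at all, these \<open>n - k\<close> classes are triangular with respect to
  suitable cells, hence independent.
\<close>

section \<open>Linear independence in abelian groups\<close>

text \<open>Indexing by \<open>I\<close> lets \<open>card I\<close> survive when the members are
  replaced along an exact sequence; with sets, injectivity would have to be reproved for every
  replacement.\<close>

definition independent_family :: "('a, 'b) monoid_scheme \<Rightarrow> 'i set \<Rightarrow> ('i \<Rightarrow> 'a) \<Rightarrow> bool"
  where "independent_family G I v \<longleftrightarrow> finite I \<and> v \<in> I \<rightarrow> carrier G \<and>
    (\<forall>c :: 'i \<Rightarrow> int. (\<Otimes>\<^bsub>G\<^esub>i\<in>I. v i [^]\<^bsub>G\<^esub> c i) = \<one>\<^bsub>G\<^esub> \<longrightarrow> (\<forall>i\<in>I. c i = 0))"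

lemma independent_familyD:
  fixes c :: "'i \<Rightarrow> int"
  assumes "independent_family G I v" "(\<Otimes>\<^bsub>G\<^esub>i\<in>I. v i [^]\<^bsub>G\<^esub> c i) = \<one>\<^bsub>G\<^esub>" "i \<in> I"
  shows "c i = 0"
  using assms unfolding independent_family_def by blast

lemma independent_in_iff_family: "independent_in G B \<longleftrightarrow> independent_family G B (\<lambda>b. b)"
  unfolding independent_in_def independent_family_def by blast

lemma hom_finprod:
  assumes "comm_group G" "comm_group H" "h \<in> hom G H" "f \<in> I \<rightarrow> carrier G"
  shows "h (finprod G f I) = finprod H (\<lambda>i. h (f i)) I"
proof -
  interpret G: comm_group G by fact
  interpret H: comm_group H by fact
  have one: "h \<one>\<^bsub>G\<^esub> = \<one>\<^bsub>H\<^esub>" using hom_one[OF assms(3)] by simp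
  \<comment> \<open>An infinite product has the default value one on both sides, so that case
    reduces to \<open>one\<close>, like the empty product.\<close>
  show ?thesis using assms(4)
  proof (induction I rule: infinite_finite_induct)
    case (insert i I)
    then have f: "f \<in> I \<rightarrow> carrier G" "f i \<in> carrier G" by auto
    moreover have "(\<lambda>i. h (f i)) \<in> I \<rightarrow> carrier H" "h (f i) \<in> carrier H"
      using f hom_in_carrier[OF assms(3)] by auto
    ultimately show ?case
      using insert by (simp add: hom_mult[OF assms(3)] G.finprod_closed)
  qed (simp_all add: one)
qed

lemma (in comm_group) finprod_pow:
  fixes e :: "'i \<Rightarrow> int"
  assumes "x \<in> carrier G"
  shows "(\<Otimes>i\<in>I. x [^] e i) = x [^] (\<Sum>i\<in>I. e i)"
  using assms by (induction I rule: infinite_finite_induct) (auto simp: int_pow_mult)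

text \<open>Any choice of preimages works: \<open>f\<close> turns a relation between them into the
  same relation between the \<open>v i\<close>.\<close>

lemma independent_family_lift:
  assumes "comm_group A" "comm_group G" "f \<in> hom A G" "independent_family G I v" "v ` I \<subseteq> f ` carrier A"
  obtains a where "independent_family A I a"
proof -
  interpret A: comm_group A by fact
  interpret G: comm_group G by fact
  have "\<forall>i\<in>I. \<exists>x\<in>carrier A. f x = v i" using assms(5) by fastforce
  then obtain a where a: "\<And>i. i \<in> I \<Longrightarrow> a i \<in> carrier A \<and> f (a i) = v i" by metis
  have "independent_family A I a"
    unfolding independent_family_def
  proof (intro conjI allI impI ballI)
    show "finite I" using assms(4) by (simp add: independent_family_def)
    show "a \<in> I \<rightarrow> carrier A" using a by blast
    fix c :: "_ \<Rightarrow> int" and i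
    assume c: "(\<Otimes>\<^bsub>A\<^esub>i\<in>I. a i [^]\<^bsub>A\<^esub> c i) = \<one>\<^bsub>A\<^esub>" and i: "i \<in> I"
    have "(\<Otimes>\<^bsub>G\<^esub>i\<in>I. v i [^]\<^bsub>G\<^esub> c i) = (\<Otimes>\<^bsub>G\<^esub>i\<in>I. f (a i [^]\<^bsub>A\<^esub> c i))"
    proof (rule G.finprod_cong')
      show "v i [^]\<^bsub>G\<^esub> c i = f (a i [^]\<^bsub>A\<^esub> c i)" if "i \<in> I" for i
        using a[OF that] by (simp add: hom_int_pow[OF assms(3)])
      show "(\<lambda>i. f (a i [^]\<^bsub>A\<^esub> c i)) \<in> I \<rightarrow> carrier G"
        using a hom_in_carrier[OF assms(3)] by auto
    qed simp
    also have "\<dots> = f \<one>\<^bsub>A\<^esub>"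
      using a by (subst hom_finprod[OF assms(1-3), symmetric]) (auto simp: c)
    also have "\<dots> = \<one>\<^bsub>G\<^esub>" using hom_one[OF assms(3)] by simp
    finally show "c i = 0" using independent_familyD[OF assms(4)] i by blast
  qed
  then show thesis by (rule that)
qed

text \<open>Rank-nullity for a map to the integers: passing to its kernel costs at most one member.
  A member outside the kernel serves as a pivot for clearing the others.\<close>

lemma independent_family_to_integers:
  fixes g :: "'a \<Rightarrow> int"
  assumes "comm_group G" "g \<in> hom G integer_group" "independent_family G I v"
  obtains J w where "J \<subseteq> I" "card I \<le> card J + 1" "independent_family G J w" "\<And>i. i \<in> J \<Longrightarrow> g (w i) = 0"
proof (cases "\<forall>i\<in>I. g (v i) = 0")
  case True
  then show thesis using that[of I v] assms(3) by auto
next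
  case False
  then obtain i0 where i0: "i0 \<in> I" "g (v i0) \<noteq> 0" by blast
  interpret G: comm_group G by fact
  have fin: "finite I" and v: "\<And>i. i \<in> I \<Longrightarrow> v i \<in> carrier G"
    using assms(3) by (auto simp: independent_family_def)
  define J where "J = I - {i0}"
  \<comment> \<open>Additively this is \<open>g (v i0) * v i - g (v i) * v i0\<close>, which
    \<open>g\<close> sends to 0.\<close>
  define w where "w = (\<lambda>i. v i [^]\<^bsub>G\<^esub> g (v i0) \<otimes>\<^bsub>G\<^esub> v i0 [^]\<^bsub>G\<^esub> (- g (v i)))"
  have w: "w i \<in> carrier G" if "i \<in> I" for i using v that i0 by (simp add: w_def)
  have "independent_family G J w"
    unfolding independent_family_def
  proof (intro conjI allI impI ballI)
    show "finite J" using fin by (simp add: J_def)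
    show "w \<in> J \<rightarrow> carrier G" using w by (auto simp: J_def)
    fix c :: "_ \<Rightarrow> int" and i
    assume c: "(\<Otimes>\<^bsub>G\<^esub>i\<in>J. w i [^]\<^bsub>G\<^esub> c i) = \<one>\<^bsub>G\<^esub>" and i: "i \<in> J"
    \<comment> \<open>A relation between the \<open>w i\<close> with coefficients \<open>c\<close>
      is one between the \<open>v i\<close> with coefficients \<open>c'\<close>; the pivot collects
      a contribution from every \<open>w i\<close>.\<close>
    define c' where "c' = (\<lambda>i. if i = i0 then \<Sum>i\<in>J. - g (v i) * c i else g (v i0) * c i)"
    have vJ: "\<And>i. i \<in> J \<Longrightarrow> v i \<in> carrier G" "v i0 \<in> carrier G" using v i0 by (auto simp: J_def)
    have I: "I = insert i0 J" using i0 by (auto simp: J_def)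
    have "(\<Otimes>\<^bsub>G\<^esub>i\<in>I. v i [^]\<^bsub>G\<^esub> c' i)
      = v i0 [^]\<^bsub>G\<^esub> c' i0 \<otimes>\<^bsub>G\<^esub> (\<Otimes>\<^bsub>G\<^esub>i\<in>J. v i [^]\<^bsub>G\<^esub> c' i)"
      unfolding I using vJ fin by (intro G.finprod_insert) (auto simp: J_def)
    also have "v i0 [^]\<^bsub>G\<^esub> c' i0 = (\<Otimes>\<^bsub>G\<^esub>i\<in>J. v i0 [^]\<^bsub>G\<^esub> (- g (v i) * c i))"
      using vJ by (simp only: G.finprod_pow) (simp add: c'_def)
    also have "(\<Otimes>\<^bsub>G\<^esub>i\<in>J. v i0 [^]\<^bsub>G\<^esub> (- g (v i) * c i)) \<otimes>\<^bsub>G\<^esub> (\<Otimes>\<^bsub>G\<^esub>i\<in>J. v i [^]\<^bsub>G\<^esub> c' i)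
      = (\<Otimes>\<^bsub>G\<^esub>i\<in>J. v i0 [^]\<^bsub>G\<^esub> (- g (v i) * c i) \<otimes>\<^bsub>G\<^esub> v i [^]\<^bsub>G\<^esub> c' i)"
      using vJ by (intro G.finprod_multf[symmetric]) auto
    also have "\<dots> = (\<Otimes>\<^bsub>G\<^esub>i\<in>J. w i [^]\<^bsub>G\<^esub> c i)"
    proof (rule G.finprod_cong')
      show "(\<lambda>i. w i [^]\<^bsub>G\<^esub> c i) \<in> J \<rightarrow> carrier G" using w by (auto simp: J_def)
      fix i assume i: "i \<in> J"
      then have ne: "i \<noteq> i0" by (simp add: J_def)
      show "v i0 [^]\<^bsub>G\<^esub> (- g (v i) * c i) \<otimes>\<^bsub>G\<^esub> v i [^]\<^bsub>G\<^esub> c' i = w i [^]\<^bsub>G\<^esub> c i"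
        unfolding w_def c'_def using ne vJ(1)[OF i] vJ(2)
        by (subst G.int_pow_distrib) (simp_all add: G.int_pow_pow G.m_comm)
    qed simp
    finally have "(\<Otimes>\<^bsub>G\<^esub>i\<in>I. v i [^]\<^bsub>G\<^esub> c' i) = \<one>\<^bsub>G\<^esub>" using c by simp
    then have "c' i = 0" using independent_familyD[OF assms(3)] i by (auto simp: J_def)
    then show "c i = 0" using i i0(2) by (auto simp: c'_def J_def)
  qed
  moreover have "g (w i) = 0" if "i \<in> J" for i
  proof -
    have "v i \<in> carrier G" "v i0 \<in> carrier G" using v i0 that by (auto simp: J_def)
    then have "g (w i) = g (v i [^]\<^bsub>G\<^esub> g (v i0)) + g (v i0 [^]\<^bsub>G\<^esub> (- g (v i)))"
      unfolding w_def using hom_mult[OF assms(2)] by simp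
    also have "\<dots> = g (v i) [^]\<^bsub>integer_group\<^esub> g (v i0) + g (v i0) [^]\<^bsub>integer_group\<^esub> (- g (v i))"
      using \<open>v i \<in> carrier G\<close> \<open>v i0 \<in> carrier G\<close> by (simp add: hom_int_pow[OF assms(2)])
    also have "\<dots> = 0" by simp
    finally show ?thesis .
  qed
  moreover have "card I \<le> card J + 1" using fin i0 by (simp add: J_def)
  ultimately show thesis using that[of J w] by (auto simp: J_def)
qed

lemma independent_family_trivial_group:
  assumes "comm_group G" "trivial_group G" "independent_family G I v"
  shows "I = {}"
proof (rule ccontr)
  assume "I \<noteq> {}"
  interpret G: comm_group G by fact
  have "v i [^]\<^bsub>G\<^esub> (1::int) = \<one>\<^bsub>G\<^esub>" if "i \<in> I" for i
  proof -
    have "v i \<in> carrier G" using assms(3) that by (auto simp: independent_family_def)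
    then have "v i [^]\<^bsub>G\<^esub> (1::int) \<in> carrier G" by (rule G.int_pow_closed)
    then show ?thesis using assms(2) by (simp add: trivial_group_def)
  qed
  then have "(\<Otimes>\<^bsub>G\<^esub>i\<in>I. v i [^]\<^bsub>G\<^esub> (1::int)) = \<one>\<^bsub>G\<^esub>"
    by (rule G.finprod_one_eqI)
  then show False
    using independent_familyD[OF assms(3), of "\<lambda>_. 1"] \<open>I \<noteq> {}\<close> by auto
qed

text \<open>Returns from families to the sets over which \<open>abelian_group_rank\<close> takes its
  supremum.\<close>

lemma independent_family_image:
  assumes "comm_group G" "independent_family G I v"
  shows "inj_on v I" "independent_in G (v ` I)"
proof -
  interpret G: comm_group G by fact
  have fin: "finite I" and v: "\<And>i. i \<in> I \<Longrightarrow> v i \<in> carrier G"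
    using assms(2) by (auto simp: independent_family_def)
  show inj: "inj_on v I"
  proof (rule inj_onI, rule ccontr)
    fix i j assume ij: "i \<in> I" "j \<in> I" "v i = v j" "i \<noteq> j"
    \<comment> \<open>If \<open>v i = v j\<close>, these coefficients form a nontrivial
      relation.\<close>
    define c :: "_ \<Rightarrow> int" where "c = (\<lambda>l. if l = i then 1 else if l = j then - 1 else 0)"
    have I: "I = insert i (insert j (I - {i, j}))" using ij by blast
    have "(\<Otimes>\<^bsub>G\<^esub>l\<in>I - {i, j}. v l [^]\<^bsub>G\<^esub> c l) = \<one>\<^bsub>G\<^esub>"
      using v by (intro G.finprod_one_eqI) (auto simp: c_def)
    then have "(\<Otimes>\<^bsub>G\<^esub>l\<in>I. v l [^]\<^bsub>G\<^esub> c l) = v i \<otimes>\<^bsub>G\<^esub> inv\<^bsub>G\<^esub> v j"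
      using ij v fin by (subst I, subst G.finprod_insert; (subst G.finprod_insert)?)
        (auto simp: c_def G.int_pow_neg)
    also have "\<dots> = \<one>\<^bsub>G\<^esub>" using ij v by simp
    finally have "c i = 0" using independent_familyD[OF assms(2)] ij by blast
    then show False by (simp add: c_def)
  qed
  show "independent_in G (v ` I)"
    unfolding independent_in_def
  proof (intro conjI allI impI ballI)
    fix c :: "_ \<Rightarrow> int" and b
    assume c: "(\<Otimes>\<^bsub>G\<^esub>b\<in>v ` I. b [^]\<^bsub>G\<^esub> c b) = \<one>\<^bsub>G\<^esub>" and "b \<in> v ` I"
    then obtain i where i: "i \<in> I" "b = v i" by blast
    have "(\<Otimes>\<^bsub>G\<^esub>i\<in>I. v i [^]\<^bsub>G\<^esub> c (v i)) = \<one>\<^bsub>G\<^esub>"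
      using v c by (subst (asm) G.finprod_reindex[OF _ inj]) auto
    from independent_familyD[OF assms(2) this i(1)] show "c b = 0" using i by simp
  qed (use fin v in auto)
qed

text \<open>Applying \<open>\<phi> i\<close> to a relation kills the terms after \<open>i\<close> by
  \<open>upper\<close>; those before \<open>i\<close> have coefficient 0 by induction, so
  \<open>diag\<close> applies to the one remaining term.\<close>

lemma independent_family_triangular:
  fixes z :: "nat \<Rightarrow> 'a" and \<phi> :: "nat \<Rightarrow> 'a \<Rightarrow> 'c"
  assumes G: "comm_group G" and H: "\<And>i. comm_group (H i)" and \<phi>: "\<And>i. i < N \<Longrightarrow> \<phi> i \<in> hom G (H i)"
    and z: "\<And>i. i < N \<Longrightarrow> z i \<in> carrier G"
    and diag: "\<And>i (c::int). i < N \<Longrightarrow> \<phi> i (z i) [^]\<^bsub>H i\<^esub> c = \<one>\<^bsub>H i\<^esub> \<Longrightarrow> c = 0"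
    and upper: "\<And>i j. i < j \<Longrightarrow> j < N \<Longrightarrow> \<phi> i (z j) = \<one>\<^bsub>H i\<^esub>"
  shows "independent_family G {..<N} z"
  unfolding independent_family_def
proof (intro conjI allI impI ballI)
  interpret G: comm_group G by fact
  fix c :: "nat \<Rightarrow> int" and i
  assume c: "(\<Otimes>\<^bsub>G\<^esub>i\<in>{..<N}. z i [^]\<^bsub>G\<^esub> c i) = \<one>\<^bsub>G\<^esub>" and "i \<in> {..<N}"
  then have "i < N" by simp
  then show "c i = 0"
  proof (induction i rule: less_induct)
    case (less i)
    interpret H: comm_group "H i" by (rule H)
    let ?f = "\<lambda>j. \<phi> i (z j) [^]\<^bsub>H i\<^esub> c j"
    have hz: "\<phi> i (z j) \<in> carrier (H i)" if "j < N" for j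
      using hom_in_carrier[OF \<phi>] less.prems z that by blast
    have "\<one>\<^bsub>H i\<^esub> = \<phi> i (\<Otimes>\<^bsub>G\<^esub>i\<in>{..<N}. z i [^]\<^bsub>G\<^esub> c i)"
      using hom_one[OF \<phi>[OF less.prems]] c by simp
    also have "\<dots> = (\<Otimes>\<^bsub>H i\<^esub>j\<in>{..<N}. \<phi> i (z j [^]\<^bsub>G\<^esub> c j))"
      using z by (intro hom_finprod[OF G H \<phi>[OF less.prems]]) auto
    also have "\<dots> = (\<Otimes>\<^bsub>H i\<^esub>j\<in>{..<N}. if i = j then ?f j else \<one>\<^bsub>H i\<^esub>)"
    proof (rule H.finprod_cong')
      show "(\<lambda>j. if i = j then ?f j else \<one>\<^bsub>H i\<^esub>) \<in> {..<N} \<rightarrow> carrier (H i)"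
        using hz by auto
      fix j assume j: "j \<in> {..<N}"
      then have "\<phi> i (z j [^]\<^bsub>G\<^esub> c j) = ?f j"
        using z by (simp add: hom_int_pow[OF \<phi>[OF less.prems]])
      moreover have "?f j = \<one>\<^bsub>H i\<^esub>" if "i \<noteq> j"
      proof (cases "j < i")
        case True then show ?thesis using less.IH[OF True] j hz by simp
      next
        case False then show ?thesis using upper[of i j] j that by simp
      qed
      ultimately show "\<phi> i (z j [^]\<^bsub>G\<^esub> c j) = (if i = j then ?f j else \<one>\<^bsub>H i\<^esub>)" by simp
    qed simp
    also have "\<dots> = ?f i"
      using less.prems hz by (intro H.finprod_singleton) auto
    finally show ?case using diag[OF less.prems] by simp
  qed
qed (use z in auto)

section \<open>The pair sequence of geometric realizations\<close>

text \<open>Kept apart from the topology so that a subcomplex gives a subset of the realization of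
  the larger complex, as relative homology requires.\<close>

definition realization_points :: "'a set set \<Rightarrow> ('a \<Rightarrow> real) set"
  where "realization_points K =
    {f. (\<forall>v. 0 \<le> f v) \<and> {v. f v \<noteq> 0} \<in> K \<and> (\<Sum>v | f v \<noteq> 0. f v) = 1}"

definition simplicial_complex :: "'a set set \<Rightarrow> bool"
  where "simplicial_complex K \<longleftrightarrow>
    (\<forall>\<sigma>\<in>K. finite \<sigma> \<and> \<sigma> \<noteq> {} \<and> (\<forall>\<tau>. \<tau> \<subseteq> \<sigma> \<and> \<tau> \<noteq> {} \<longrightarrow> \<tau> \<in> K))"

lemma simplicial_complex_face:
  "simplicial_complex K \<Longrightarrow> \<sigma> \<in> K \<Longrightarrow> \<tau> \<subseteq> \<sigma> \<Longrightarrow> \<tau> \<noteq> {} \<Longrightarrow> \<tau> \<in> K"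
  unfolding simplicial_complex_def by blast

lemma simplicial_complex_finite: "simplicial_complex K \<Longrightarrow> \<sigma> \<in> K \<Longrightarrow> finite \<sigma>"
  unfolding simplicial_complex_def by blast

text \<open>The complement of the open star of \<open>\<sigma>\<close>.\<close>

definition delete_star :: "'a set set \<Rightarrow> 'a set \<Rightarrow> 'a set set"
  where "delete_star K \<sigma> = {\<tau> \<in> K. \<not> \<sigma> \<subseteq> \<tau>}"

definition pair_homology :: "int \<Rightarrow> 'a set set \<Rightarrow> 'a set set \<Rightarrow> ('a \<Rightarrow> real) chain set monoid"
  where "pair_homology i K L =
    relative_homology_group i (geometric_realization K) (realization_points L)"

definition pair_map :: "int \<Rightarrow> 'a set set \<Rightarrow> 'a set set \<Rightarrow> 'a set set \<Rightarrow> 'a set set \<Rightarrow>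
    ('a \<Rightarrow> real) chain set \<Rightarrow> ('a \<Rightarrow> real) chain set"
  where "pair_map i K L K' L' =
    hom_induced i (geometric_realization K) (realization_points L)
      (geometric_realization K') (realization_points L') id"

text \<open>The connecting map of the triple \<open>M \<subseteq> L \<subseteq> K\<close>.\<close>

definition triple_boundary :: "int \<Rightarrow> 'a set set \<Rightarrow> 'a set set \<Rightarrow> 'a set set \<Rightarrow>
    ('a \<Rightarrow> real) chain set \<Rightarrow> ('a \<Rightarrow> real) chain set"
  where "triple_boundary i K L M =
    hom_relboundary i (geometric_realization K) (realization_points L) (realization_points M)"

text \<open>With \<open>top_of_set\<close>, continuity of maps between realizations becomes
  \<open>continuous_on\<close>, which can be checked coordinatewise.\<close>

lemma geometric_realization_eq: "geometric_realization K = top_of_set (realization_points K)"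
  by (simp add: geometric_realization_def realization_points_def euclidean_product_topology)

lemma realization_points_empty [simp]: "realization_points {} = {}"
  by (simp add: realization_points_def)

lemma realization_points_mono: "L \<subseteq> K \<Longrightarrow> realization_points L \<subseteq> realization_points K"
  by (auto simp: realization_points_def)

lemma subtopology_geometric_realization:
  "L \<subseteq> K \<Longrightarrow> subtopology (geometric_realization K) (realization_points L) = geometric_realization L"
  using realization_points_mono[of L K]
  by (auto simp: geometric_realization_eq subtopology_subtopology Int_absorb1)

lemma continuous_map_id_realization:
  "L \<subseteq> K \<Longrightarrow> continuous_map (geometric_realization L) (geometric_realization K) id"
  using realization_points_mono[of L K] by (auto simp: geometric_realization_eq)

lemma homology_group_realization: "homology_group i (geometric_realization K) = pair_homology i K {}"
  by (simp add: pair_homology_def)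

lemma comm_group_pair_homology [simp]: "comm_group (pair_homology i K L)"
  and group_pair_homology [simp]: "group (pair_homology i K L)"
  by (simp_all add: pair_homology_def)

lemma pair_map_hom: "pair_map i K L K' L' \<in> hom (pair_homology i K L) (pair_homology i K' L')"
  by (simp add: pair_homology_def pair_map_def hom_induced_hom)

lemma pair_map_carrier: "pair_map i K L K' L' c \<in> carrier (pair_homology i K' L')"
  by (simp add: pair_homology_def pair_map_def hom_induced_carrier)

lemma pair_map_id: "c \<in> carrier (pair_homology i K L) \<Longrightarrow> pair_map i K L K L c = c"
  by (simp add: pair_homology_def pair_map_def hom_induced_id)

lemma pair_map_compose:
  assumes "K \<subseteq> K'" "L \<subseteq> L'" "K' \<subseteq> K''" "L' \<subseteq> L''"
  shows "pair_map i K' L' K'' L'' (pair_map i K L K' L' c) = pair_map i K L K'' L'' c"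
  using assms realization_points_mono[of L L'] realization_points_mono[of L' L'']
  unfolding pair_map_def
  by (subst hom_induced_compose') (auto intro: continuous_map_id_realization)

lemma triple_boundary_hom:
  assumes "L \<subseteq> K"
  shows "triple_boundary i K L M \<in> hom (pair_homology i K L) (pair_homology (i - 1) L M)"
  using group_homomorphism_hom_relboundary[of i "geometric_realization K" "realization_points L"]
  by (simp add: pair_homology_def triple_boundary_def subtopology_geometric_realization[OF assms])

text \<open>The long exact sequence of the triple, with the subspace of \<open>K\<close> carried by
  \<open>L\<close> identified with the realization of \<open>L\<close>.\<close>

lemma triple_exact:
  assumes "L \<subseteq> K" "M \<subseteq> L"
  shows triple_exact_total:
      "kernel (pair_homology i K L) (pair_homology (i - 1) L M) (triple_boundary i K L M)
        = pair_map i K M K L ` carrier (pair_homology i K M)"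
    and triple_exact_sub:
      "kernel (pair_homology i L M) (pair_homology i K M) (pair_map i L M K M)
        = triple_boundary (i + 1) K L M ` carrier (pair_homology (i + 1) K L)"
    and triple_exact_mid:
      "kernel (pair_homology i K M) (pair_homology i K L) (pair_map i K M K L)
        = pair_map i L M K M ` carrier (pair_homology i L M)"
proof -
  have *: "realization_points M \<subseteq> realization_points L"
    by (simp add: assms realization_points_mono)
  note ex = homology_exactness_triple_1[OF *, of i "geometric_realization K"]
     homology_exactness_triple_2[OF *, of "i + 1" "geometric_realization K"]
     homology_exactness_triple_3[OF *, of i "geometric_realization K"]
  show "kernel (pair_homology i K L) (pair_homology (i - 1) L M) (triple_boundary i K L M)
        = pair_map i K M K L ` carrier (pair_homology i K M)"
    "kernel (pair_homology i L M) (pair_homology i K M) (pair_map i L M K M)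
        = triple_boundary (i + 1) K L M ` carrier (pair_homology (i + 1) K L)"
    "kernel (pair_homology i K M) (pair_homology i K L) (pair_map i K M K L)
        = pair_map i L M K M ` carrier (pair_homology i L M)"
    using ex
    by (auto simp: pair_homology_def triple_boundary_def pair_map_def
       subtopology_geometric_realization[OF assms(1)])
qed

section \<open>Isomorphisms from vanishing terms of exact sequences\<close>

lemma iso_of_exact:
  assumes "group G" "group H" "h \<in> hom G H" "kernel G H h \<subseteq> {\<one>\<^bsub>G\<^esub>}" "carrier H \<subseteq> h ` carrier G"
  shows "h \<in> iso G H"
proof -
  interpret group_hom G H h
    using assms by (simp add: group_hom_def group_hom_axioms_def)
  have "kernel G H h = {\<one>\<^bsub>G\<^esub>}"
    using assms(4) one_closed by (auto simp: kernel_def)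
  then show ?thesis
    using assms inj_iff_trivial_ker trivial_ker_imp_inj
    by (auto simp: iso_def bij_betw_def)
qed

text \<open>From the exact sequence of the triple \<open>X\<close>, \<open>S\<close>,
  \<open>T\<close>. It is stated for spaces because \<open>S\<close> will be a realization with one
  point removed, which is not given by a subcomplex.\<close>

lemma iso_of_trivial_relative:
  assumes "T \<subseteq> S" "\<And>i. trivial_group (relative_homology_group i (subtopology X S) T)"
  shows "hom_induced i X T X S id \<in> iso (relative_homology_group i X T) (relative_homology_group i X S)"
proof (rule iso_of_exact)
  note ex = homology_exactness_triple_1[OF assms(1), of i X]
     homology_exactness_triple_3[OF assms(1), of i X]
  have tr: "carrier (relative_homology_group i (subtopology X S) T) = {\<one>\<^bsub>relative_homology_group i (subtopology X S) T\<^esub>}" for i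
    using assms(2) by (simp add: trivial_group_def)
  have "hom_induced i (subtopology X S) T X T id \<one>\<^bsub>relative_homology_group i (subtopology X S) T\<^esub> = \<one>\<^bsub>relative_homology_group i X T\<^esub>"
    by (metis hom_induced_hom hom_one group_relative_homology_group)
  then show "kernel (relative_homology_group i X T) (relative_homology_group i X S) (hom_induced i X T X S id) \<subseteq> {\<one>\<^bsub>relative_homology_group i X T\<^esub>}"
    using ex(2) tr by simp
  show "carrier (relative_homology_group i X S) \<subseteq> hom_induced i X T X S id ` carrier (relative_homology_group i X T)"
    using ex(1) tr[of "i-1"] hom_relboundary[of i X S T] by (auto simp: kernel_def set_eq_iff)
qed (auto simp: hom_induced_hom)

section \<open>Straight-line homotopies and cones\<close>

lemma homotopic_with_linear_coordinates:
  fixes f g :: "('a \<Rightarrow> real) \<Rightarrow> 'b \<Rightarrow> real"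
  assumes "\<And>v. continuous_on S (\<lambda>x. f x v)" "\<And>v. continuous_on S (\<lambda>x. g x v)"
    and "\<And>x t. \<lbrakk>x \<in> S; 0 \<le> t; t \<le> 1\<rbrakk> \<Longrightarrow> (\<lambda>v. (1 - t) * f x v + t * g x v) \<in> T"
  shows "homotopic_with_canon (\<lambda>h. True) S T f g"
proof -
  have c: "continuous_on ({0..1} \<times> S) (\<lambda>z v. (1 - fst z) * f (snd z) v + fst z * g (snd z) v)"
    by (intro continuous_on_coordinatewise_then_product continuous_intros
        continuous_on_compose2[OF assms(1)] continuous_on_compose2[OF assms(2)]) auto
  show ?thesis
    unfolding homotopic_with_def
    using c assms(3)
    by (intro exI[of _ "\<lambda>z v. (1 - fst z) * f (snd z) v + fst z * g (snd z) v"])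
       (auto simp: continuous_map_subtopology_eu simp flip: subtopology_Times)
qed


text \<open>Summing over any finite \<open>A\<close> that contains the support avoids computing the
  support exactly.\<close>

lemma realization_pointsI:
  assumes "\<And>v. 0 \<le> f v" "{v. f v \<noteq> 0} \<in> K" "finite A" "{v. f v \<noteq> 0} \<subseteq> A" "sum f A = 1"
  shows "f \<in> realization_points K"
proof -
  have "sum f {v. f v \<noteq> 0} = sum f A"
    using assms by (intro sum.mono_neutral_left) auto
  then show ?thesis
    using assms by (simp add: realization_points_def)
qed

lemma realization_pointsD:
  assumes "f \<in> realization_points K"
  shows "0 \<le> f v" "{v. f v \<noteq> 0} \<in> K"
    and "finite A \<Longrightarrow> {v. f v \<noteq> 0} \<subseteq> A \<Longrightarrow> sum f A = 1"
proof -
  show "0 \<le> f v" "{v. f v \<noteq> 0} \<in> K"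
    using assms by (auto simp: realization_points_def)
  assume A: "finite A" "{v. f v \<noteq> 0} \<subseteq> A"
  then have "sum f {v. f v \<noteq> 0} = sum f A"
    by (intro sum.mono_neutral_left) auto
  then show "sum f A = 1"
    using assms by (simp add: realization_points_def)
qed

text \<open>For \<open>0 < t < 1\<close> the support is the union of both supports, as nonnegative
  terms cannot cancel; at the ends the combination is \<open>f\<close> or \<open>g\<close>
  itself.\<close>

lemma convex_combination_realization_points:
  fixes f g :: "'a \<Rightarrow> real"
  assumes f: "f \<in> realization_points K" and g: "g \<in> realization_points K"
    and fin: "\<And>\<sigma>. \<sigma> \<in> K \<Longrightarrow> finite \<sigma>" and un: "{v. f v \<noteq> 0} \<union> {v. g v \<noteq> 0} \<in> K"
    and t: "0 \<le> t" "t \<le> 1"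
  shows "(\<lambda>v. (1 - t) * f v + t * g v) \<in> realization_points K"
proof -
  consider "t = 0" | "t = 1" | "0 < t" "t < 1" using t by linarith
  then show ?thesis
  proof cases
    case 3
    note fg = realization_pointsD[OF f] realization_pointsD[OF g]
    have nz: "(1 - t) * f v + t * g v \<noteq> 0 \<longleftrightarrow> f v \<noteq> 0 \<or> g v \<noteq> 0" for v
    proof -
      have "0 \<le> (1 - t) * f v" "0 \<le> t * g v" using fg t by auto
      then have "(1 - t) * f v + t * g v = 0 \<longleftrightarrow> (1 - t) * f v = 0 \<and> t * g v = 0" by linarith
      then show ?thesis using 3 by simp
    qed
    let ?A = "{v. f v \<noteq> 0} \<union> {v. g v \<noteq> 0}"
    show ?thesis
    proof (rule realization_pointsI[where A="?A"])
      show "(\<Sum>v\<in>?A. (1 - t) * f v + t * g v) = 1"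
        using fg(3,6)[of ?A] fin[OF un] by (simp add: sum.distrib flip: sum_distrib_left)
      have "{v. (1 - t) * f v + t * g v \<noteq> 0} = ?A" using nz by auto
      then show "{v. (1 - t) * f v + t * g v \<noteq> 0} \<in> K" using un by simp
      show "{v. (1 - t) * f v + t * g v \<noteq> 0} \<subseteq> ?A" using nz by auto
    qed (use fg t fin[OF un] in auto)
  qed (use f g in auto)
qed

text \<open>Segments from the apex \<open>v\<close> stay in \<open>K\<close>, respectively in
  \<open>L\<close>, so the constant map to \<open>v\<close>, with value in \<open>L\<close>, is
  homotopic to the identity on both.\<close>

lemma trivial_pair_homology_cone:
  assumes K: "simplicial_complex K" and L: "simplicial_complex L" "L \<subseteq> K"
    and v: "{v} \<in> L" "\<And>\<tau>. \<tau> \<in> K \<Longrightarrow> insert v \<tau> \<in> K" "\<And>\<tau>. \<tau> \<in> L \<Longrightarrow> insert v \<tau> \<in> L"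
  shows "trivial_group (pair_homology i K L)"
proof -
  let ?e = "\<lambda>w. if w = v then 1 else (0::real)"
  have e: "?e \<in> realization_points L"
    by (rule realization_pointsI[where A="{v}"]) (use v in auto)
  have eK: "?e \<in> realization_points K"
    using e realization_points_mono[OF L(2)] by auto
  have hom: "homotopic_with_canon (\<lambda>h. True) (realization_points M) (realization_points M) (\<lambda>f. ?e) id"
    if M: "simplicial_complex M" "\<And>\<tau>. \<tau> \<in> M \<Longrightarrow> insert v \<tau> \<in> M" "?e \<in> realization_points M" for M
  proof (rule homotopic_with_linear_coordinates)
    fix x t assume x: "x \<in> realization_points M" "0 \<le> t" "t \<le> (1::real)"
    have "{w. ?e w \<noteq> 0} \<union> {w. x w \<noteq> 0} = insert v {w. x w \<noteq> 0}" by auto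
    then have "{w. ?e w \<noteq> 0} \<union> {w. x w \<noteq> 0} \<in> M"
      using M(2) realization_pointsD(2)[OF x(1)] by metis
    moreover have "finite \<sigma>" if "\<sigma> \<in> M" for \<sigma>
      using that M(1) by (simp add: simplicial_complex_def)
    ultimately show "(\<lambda>w. (1 - t) * ?e w + t * id x w) \<in> realization_points M"
      using convex_combination_realization_points[OF M(3) x(1) _ _ x(2,3)] by simp
  qed (simp_all add: continuous_on_subset[OF continuous_on_product_coordinates])
  show ?thesis
    unfolding pair_homology_def
  proof (rule trivial_relative_homology_group_gen)
    show "continuous_map (geometric_realization K) (subtopology (geometric_realization K) (realization_points L)) (\<lambda>f. ?e)"
      using e by (auto simp: subtopology_geometric_realization[OF L(2)]) (auto simp: geometric_realization_eq)
    show "homotopic_with (\<lambda>h. True) (subtopology (geometric_realization K) (realization_points L))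
       (subtopology (geometric_realization K) (realization_points L)) (\<lambda>f. ?e) id"
      unfolding subtopology_geometric_realization[OF L(2)]
      unfolding geometric_realization_eq by (rule hom[OF L(1) v(3) e])
    show "homotopic_with (\<lambda>h. True) (geometric_realization K) (geometric_realization K) (\<lambda>f. ?e) id"
      using hom[OF K v(2) eK] by (simp add: geometric_realization_eq)
  qed
qed

lemma pair_homology_singleton:
  shows "i \<noteq> 0 \<Longrightarrow> trivial_group (pair_homology i {{v}} {})"
    and "pair_homology 0 {{v}} {} \<cong> integer_group"
proof -
  let ?e = "\<lambda>w. if w = v then 1 else (0::real)"
  have 1: "f = ?e" if f: "f \<in> realization_points {{v}}" for f
  proof
    fix w
    have "{w. f w \<noteq> 0} = {v}" using realization_pointsD(2)[OF f] by simp
    then have "f w \<noteq> 0 \<longleftrightarrow> w = v" by blast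
    moreover have "f v = 1"
      using realization_pointsD(3)[OF f, of "{v}"] \<open>{w. f w \<noteq> 0} = {v}\<close> by simp
    ultimately show "f w = ?e w" by auto
  qed
  have "{w. ?e w \<noteq> 0} = {v}" by simp
  then have "?e \<in> realization_points {{v}}"
    by (intro realization_pointsI[where A="{v}"]) simp_all
  with 1 have "realization_points {{v}} = {?e}" by blast
  then have "topspace (geometric_realization {{v}}) = {?e}"
    by (simp add: geometric_realization_eq)
  from homology_dimension_axiom[OF this] homology_coefficients[OF this]
  show "i \<noteq> 0 \<Longrightarrow> trivial_group (pair_homology i {{v}} {})"
    "pair_homology 0 {{v}} {} \<cong> integer_group"
    by (simp_all add: pair_homology_def)
qed

section \<open>Deleting open stars\<close>

definition barycenter :: "'a set \<Rightarrow> 'a \<Rightarrow> real"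
  where "barycenter \<sigma> = (\<lambda>v. if v \<in> \<sigma> then 1 / real (card \<sigma>) else 0)"

lemma continuous_on_Min_coordinates:
  assumes "finite \<sigma>" "\<sigma> \<noteq> {}"
  shows "continuous_on S (\<lambda>f :: 'a \<Rightarrow> real. Min (f ` \<sigma>))"
  using assms
proof (induction rule: finite_ne_induct)
  case (insert v \<sigma>)
  then have "(\<lambda>f :: 'a \<Rightarrow> real. Min (f ` insert v \<sigma>)) = (\<lambda>f. min (f v) (Min (f ` \<sigma>)))"
    by auto
  moreover have "continuous_on S (\<lambda>f :: 'a \<Rightarrow> real. min (f v) (Min (f ` \<sigma>)))"
    using insert.IH by (simp add: continuous_on_min continuous_on_subset[OF continuous_on_product_coordinates])
  ultimately show ?case by (simp only:)
qed (simp add: continuous_on_subset[OF continuous_on_product_coordinates])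

lemma simplicial_complex_delete_star: "simplicial_complex K \<Longrightarrow> simplicial_complex (delete_star K \<sigma>)"
  unfolding simplicial_complex_def delete_star_def by blast

lemma delete_star_subset: "delete_star K \<sigma> \<subseteq> K"
  by (auto simp: delete_star_def)

text \<open>The coordinates sum to 1, and those in \<open>\<sigma>\<close> contribute at least
  \<open>card \<sigma>\<close> times their minimum; this bound reaches 1 only at the barycenter.
  Elsewhere the denominator in \<open>push_off\<close> is therefore positive.\<close>

lemma Min_less_barycenter:
  assumes f: "f \<in> realization_points K" "f \<noteq> barycenter \<sigma>" and fin: "\<And>\<tau>. \<tau> \<in> K \<Longrightarrow> finite \<tau>"
    and \<sigma>: "finite \<sigma>" "\<sigma> \<noteq> {}"
  shows "real (card \<sigma>) * Min (f ` \<sigma>) < 1"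
proof (rule ccontr)
  assume "\<not> ?thesis"
  then have ge: "real (card \<sigma>) * Min (f ` \<sigma>) \<ge> 1" by simp
  note fD = realization_pointsD[OF f(1)]
  let ?A = "{v. f v \<noteq> 0} \<union> \<sigma>"
  have A: "finite ?A" using fD(2) fin \<sigma> by blast
  have sumA: "sum f ?A = 1" using fD(3)[OF A] by blast
  have split: "sum f ?A = sum f (?A - \<sigma>) + sum f \<sigma>"
    using A by (intro sum.subset_diff) auto
  have nn: "sum f (?A - \<sigma>) \<ge> 0" using fD(1) by (simp add: sum_nonneg)
  have le: "Min (f ` \<sigma>) \<le> f v" if "v \<in> \<sigma>" for v using that \<sigma> by simp
  have ds: "(\<Sum>v\<in>\<sigma>. f v - Min (f ` \<sigma>)) = sum f \<sigma> - real (card \<sigma>) * Min (f ` \<sigma>)"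
    by (simp add: sum_subtractf)
  have dn: "(\<Sum>v\<in>\<sigma>. f v - Min (f ` \<sigma>)) \<ge> 0" using le by (simp add: sum_nonneg)
  \<comment> \<open>The total 1 splits into the part outside \<open>\<sigma>\<close>, the excess
    over the minimum, and \<open>card \<sigma>\<close> times the minimum; \<open>ge\<close> forces
    the first two to vanish.\<close>
  have z: "(\<Sum>v\<in>\<sigma>. f v - Min (f ` \<sigma>)) = 0" "sum f (?A - \<sigma>) = 0" "real (card \<sigma>) * Min (f ` \<sigma>) = 1"
    using ge sumA split nn ds dn by linarith+
  have "\<forall>v\<in>\<sigma>. f v - Min (f ` \<sigma>) = 0"
    using z(1) le \<sigma>(1) by (subst (asm) sum_nonneg_eq_0_iff) simp_all
  then have 1: "f v = Min (f ` \<sigma>)" if "v \<in> \<sigma>" for v using that by fastforce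
  have "\<forall>v\<in>?A - \<sigma>. f v = 0"
    using z(2) fD(1) A by (subst (asm) sum_nonneg_eq_0_iff) blast+
  then have 2: "f v = 0" if "v \<notin> \<sigma>" for v using that by blast
  have "Min (f ` \<sigma>) = 1 / real (card \<sigma>)"
    using z(3) \<sigma> by (simp add: field_simps)
  then have "f = barycenter \<sigma>"
    using 1 2 by (auto simp: barycenter_def fun_eq_iff)
  then show False using f by simp
qed

text \<open>
  The point where the ray from the barycenter of \<open>\<sigma>\<close> through \<open>f\<close> leaves the open star of \<open>\<sigma>\<close>.
\<close>

definition push_off :: "'a set \<Rightarrow> ('a \<Rightarrow> real) \<Rightarrow> 'a \<Rightarrow> real"
  where "push_off \<sigma> f =
    (\<lambda>v. (f v - (if v \<in> \<sigma> then Min (f ` \<sigma>) else 0)) / (1 - real (card \<sigma>) * Min (f ` \<sigma>)))"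

text \<open>Subtracting the minimum makes some coordinate in \<open>\<sigma>\<close> vanish, which
  takes the point out of the open star; the division restores the sum 1. Off the star the minimum is
  already 0, so nothing changes there.\<close>

lemma push_off:
  assumes K: "simplicial_complex K" and f: "f \<in> realization_points K" "f \<noteq> barycenter \<sigma>"
    and \<sigma>: "finite \<sigma>" "\<sigma> \<noteq> {}"
  shows push_off_realization: "push_off \<sigma> f \<in> realization_points (delete_star K \<sigma>)"
    and push_off_support: "{v. push_off \<sigma> f v \<noteq> 0} \<subseteq> {v. f v \<noteq> 0}"
    and push_off_id: "f \<in> realization_points (delete_star K \<sigma>) \<Longrightarrow> push_off \<sigma> f = f"
proof -
  note fD = realization_pointsD[OF f(1)]
  have fin: "\<And>\<tau>. \<tau> \<in> K \<Longrightarrow> finite \<tau>" using K by (simp add: simplicial_complex_def)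
  define \<mu> where "\<mu> = Min (f ` \<sigma>)"
  have lt: "real (card \<sigma>) * \<mu> < 1"
    using Min_less_barycenter[OF f fin \<sigma>] by (simp add: \<mu>_def)
  have p: "push_off \<sigma> f v = (f v - (if v \<in> \<sigma> then \<mu> else 0)) / (1 - real (card \<sigma>) * \<mu>)" for v
    by (simp add: push_off_def \<mu>_def)
  have le: "\<mu> \<le> f v" if "v \<in> \<sigma>" for v using that \<sigma> by (simp add: \<mu>_def)
  obtain u where u: "u \<in> \<sigma>" "f u = \<mu>"
    using Min_in[of "f ` \<sigma>"] \<sigma> unfolding \<mu>_def
    by (metis (no_types, lifting) finite_imageI image_iff image_is_empty)
  have \<mu>0: "\<mu> \<ge> 0" using fD(1)[of u] u by simp
  have nn: "0 \<le> push_off \<sigma> f v" for v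
    using le[of v] fD(1)[of v] lt by (simp add: p)
  show sup: "{v. push_off \<sigma> f v \<noteq> 0} \<subseteq> {v. f v \<noteq> 0}"
  proof clarify
    fix v assume v: "push_off \<sigma> f v \<noteq> 0" "f v = 0"
    then have "v \<in> \<sigma>" by (auto simp: p split: if_splits)
    then have "\<mu> = 0" using le[of v] v \<mu>0 by simp
    then show False using v by (simp add: p split: if_splits)
  qed
  let ?A = "{v. f v \<noteq> 0} \<union> \<sigma>"
  have A: "finite ?A" using fD(2) fin \<sigma> by blast
  have "sum f ?A = 1" using fD(3)[OF A] by blast
  moreover have "(\<Sum>v\<in>?A. if v \<in> \<sigma> then \<mu> else 0) = real (card \<sigma>) * \<mu>"
  proof -
    have "(\<Sum>v\<in>?A. if v \<in> \<sigma> then \<mu> else 0) = (\<Sum>v\<in>?A \<inter> \<sigma>. \<mu>)"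
      by (rule sum.inter_restrict[OF A, symmetric])
    also have "?A \<inter> \<sigma> = \<sigma>" by blast
    finally show ?thesis by simp
  qed
  ultimately have s: "sum (push_off \<sigma> f) ?A = 1"
    using lt by (simp add: p sum_subtractf flip: sum_divide_distrib)
  have ne: "{v. push_off \<sigma> f v \<noteq> 0} \<noteq> {}"
  proof
    assume "{v. push_off \<sigma> f v \<noteq> 0} = {}"
    then have "sum (push_off \<sigma> f) ?A = 0" by (intro sum.neutral) auto
    then show False using s by simp
  qed
  have "push_off \<sigma> f u = 0" using u by (simp add: p)
  then have "{v. push_off \<sigma> f v \<noteq> 0} \<in> delete_star K \<sigma>"
    using K sup ne fD(2) u(1) unfolding simplicial_complex_def delete_star_def by blast
  then show "push_off \<sigma> f \<in> realization_points (delete_star K \<sigma>)"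
    using nn s A sup by (intro realization_pointsI[where A = ?A]) auto
  show "push_off \<sigma> f = f" if "f \<in> realization_points (delete_star K \<sigma>)"
  proof -
    have "\<not> \<sigma> \<subseteq> {v. f v \<noteq> 0}"
      using realization_pointsD(2)[OF that] by (simp add: delete_star_def)
    then obtain w where "w \<in> \<sigma>" "f w = 0" by blast
    then have "\<mu> = 0" using le[of w] \<mu>0 by simp
    then show ?thesis by (simp add: p fun_eq_iff)
  qed
qed

lemma barycenter_not_in_delete_star:
  assumes "finite \<sigma>" "\<sigma> \<noteq> {}"
  shows "barycenter \<sigma> \<notin> realization_points (delete_star K \<sigma>)"
proof
  assume "barycenter \<sigma> \<in> realization_points (delete_star K \<sigma>)"
  then have "{v. barycenter \<sigma> v \<noteq> 0} \<in> delete_star K \<sigma>" by (rule realization_pointsD)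
  moreover have "{v. barycenter \<sigma> v \<noteq> 0} = \<sigma>" using assms by (auto simp: barycenter_def)
  ultimately show False by (simp add: delete_star_def)
qed

lemma barycenter_in_realization:
  assumes "\<sigma> \<in> K" "finite \<sigma>" "\<sigma> \<noteq> {}"
  shows "barycenter \<sigma> \<in> realization_points K"
proof -
  have "{v. barycenter \<sigma> v \<noteq> 0} = \<sigma>" using assms by (auto simp: barycenter_def)
  then show ?thesis
    using assms by (intro realization_pointsI[where A=\<sigma>]) (auto simp: barycenter_def)
qed

text \<open>\<open>push_off \<sigma>\<close> deforms the punctured realization onto the complement
  of the open star along straight lines, so the homology of the one relative to the other
  vanishes.\<close>

lemma punctured_realization_iso:
  assumes K: "simplicial_complex K" and \<sigma>: "finite \<sigma>" "\<sigma> \<noteq> {}"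
  shows "hom_induced i (geometric_realization K) (realization_points (delete_star K \<sigma>))
      (geometric_realization K) (realization_points K - {barycenter \<sigma>}) id
    \<in> iso (pair_homology i K (delete_star K \<sigma>))
        (relative_homology_group i (geometric_realization K) (realization_points K - {barycenter \<sigma>}))"
  unfolding pair_homology_def
proof (rule iso_of_trivial_relative)
  let ?D = "realization_points (delete_star K \<sigma>)"
  let ?U = "realization_points K - {barycenter \<sigma>}"
  show DU: "?D \<subseteq> ?U"
    using realization_points_mono[OF delete_star_subset] barycenter_not_in_delete_star[OF \<sigma>] by blast
  have fin: "\<And>\<tau>. \<tau> \<in> K \<Longrightarrow> finite \<tau>" using K by (simp add: simplicial_complex_def)
  have U: "subtopology (geometric_realization K) ?U = top_of_set ?U"
    by (simp add: geometric_realization_eq subtopology_subtopology Int_absorb1)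
  have D: "subtopology (top_of_set ?U) ?D = top_of_set ?D"
    using DU by (simp add: subtopology_subtopology Int_absorb1)
  have co: "continuous_on S (\<lambda>f :: 'a \<Rightarrow> real. f v)" for S v
    by (simp add: continuous_on_subset[OF continuous_on_product_coordinates])
  have cp: "continuous_on ?U (\<lambda>f. push_off \<sigma> f v)" for v
    unfolding push_off_def
  proof (intro continuous_intros co continuous_on_Min_coordinates \<sigma>)
    show "continuous_on ?U (\<lambda>f. if v \<in> \<sigma> then Min (f ` \<sigma>) else 0)"
      by (cases "v \<in> \<sigma>") (auto intro: continuous_on_Min_coordinates \<sigma>)
    show "\<forall>f\<in>?U. 1 - real (card \<sigma>) * Min (f ` \<sigma>) \<noteq> 0"
      using Min_less_barycenter[OF _ _ fin \<sigma>, of _ K] by fastforce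
  qed
  show "trivial_group (relative_homology_group i (subtopology (geometric_realization K) ?U) ?D)" for i
    unfolding U
  proof (rule trivial_relative_homology_group_gen[where f = "push_off \<sigma>"]; (unfold D)?)
    have "continuous_on ?U (push_off \<sigma>)"
      using continuous_on_coordinatewise_then_product[of ?U "push_off \<sigma>"] cp by blast
    then show "continuous_map (top_of_set ?U) (top_of_set ?D) (push_off \<sigma>)"
      using push_off_realization[OF K _ _ \<sigma>] by auto
    show "homotopic_with_canon (\<lambda>h. True) ?D ?D (push_off \<sigma>) id"
    proof (rule homotopic_with_linear_coordinates)
      show "continuous_on ?D (\<lambda>f. push_off \<sigma> f v)" for v
        using cp DU continuous_on_subset by blast
      fix f and t :: real assume f: "f \<in> ?D"
      then have "push_off \<sigma> f = f" using push_off_id[OF K _ _ \<sigma>] DU by blast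
      then show "(\<lambda>v. (1 - t) * push_off \<sigma> f v + t * id f v) \<in> ?D"
        using f by (simp add: algebra_simps)
    qed (simp add: co)
    show "homotopic_with_canon (\<lambda>h. True) ?U ?U (push_off \<sigma>) id"
    proof (rule homotopic_with_linear_coordinates)
      fix f and t :: real assume f: "f \<in> ?U" and t: "0 \<le> t" "t \<le> 1"
      let ?h = "\<lambda>v. (1 - t) * push_off \<sigma> f v + t * id f v"
      have f': "f \<in> realization_points K" "f \<noteq> barycenter \<sigma>" using f by auto
      have pK: "push_off \<sigma> f \<in> realization_points K"
        using push_off_realization[OF K f' \<sigma>] realization_points_mono[OF delete_star_subset] by blast
      have "{v. push_off \<sigma> f v \<noteq> 0} \<union> {v. f v \<noteq> 0} = {v. f v \<noteq> 0}"
        using push_off_support[OF K f' \<sigma>] by blast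
      then have hK: "?h \<in> realization_points K"
        using convex_combination_realization_points[OF pK f'(1) fin _ t] realization_pointsD(2)[OF f'(1)]
        by simp
      \<comment> \<open>Where the coordinate of \<open>f\<close> in \<open>\<sigma>\<close> is
        minimal, that of \<open>push_off \<sigma> f\<close> is 0. The segment thus never exceeds
        \<open>f u\<close>, which is less than the barycenter's value there.\<close>
      obtain u where u: "u \<in> \<sigma>" "f u = Min (f ` \<sigma>)"
        using Min_in[of "f ` \<sigma>"] \<sigma> by (metis (no_types, lifting) finite_imageI image_iff image_is_empty)
      have "f u \<ge> 0" using realization_pointsD(1)[OF f'(1)] .
      then have "?h u \<le> f u"
        using u t by (simp add: push_off_def mult_left_le_one_le)
      moreover have "f u < 1 / real (card \<sigma>)"
        using Min_less_barycenter[OF f' fin \<sigma>] u \<sigma> card_gt_0_iff[of \<sigma>]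
        by (simp add: pos_less_divide_eq mult.commute)
      ultimately have "?h u \<noteq> barycenter \<sigma> u" using u by (simp add: barycenter_def)
      then have "?h \<noteq> barycenter \<sigma>" by metis
      then show "?h \<in> ?U" using hK by blast
    qed (simp_all add: co cp)
  qed
qed

section \<open>Excision and joins\<close>

text \<open>Removing a point leaves an open set, as excision wants. The excised set lies in
  \<open>?C\<close>, where some coordinate in \<open>\<sigma>\<close> vanishes; \<open>?C\<close> is
  closed and misses the barycenter.\<close>

lemma punctured_realization_excision:
  assumes K: "simplicial_complex K" and A: "A \<subseteq> K" "\<And>\<tau>. \<tau> \<in> K \<Longrightarrow> \<sigma> \<subseteq> \<tau> \<Longrightarrow> \<tau> \<in> A"
    and \<sigma>: "finite \<sigma>" "\<sigma> \<noteq> {}"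
  shows "hom_induced i (geometric_realization A) (realization_points A - {barycenter \<sigma>})
      (geometric_realization K) (realization_points K - {barycenter \<sigma>}) id
    \<in> iso (relative_homology_group i (geometric_realization A) (realization_points A - {barycenter \<sigma>}))
        (relative_homology_group i (geometric_realization K) (realization_points K - {barycenter \<sigma>}))"
proof -
  let ?X = "geometric_realization K"
  let ?U = "realization_points K - realization_points A"
  let ?T = "realization_points K - {barycenter \<sigma>}"
  let ?C = "realization_points K \<inter> (\<Union>v\<in>\<sigma>. {f. f v = (0::real)})"
  have AK: "realization_points A \<subseteq> realization_points K" by (rule realization_points_mono[OF A(1)])
  have "closed {f :: 'a \<Rightarrow> real. f v = 0}" for v
    by (intro closed_Collect_eq continuous_on_product_coordinates continuous_on_const)
  then have "closed (\<Union>v\<in>\<sigma>. {f :: 'a \<Rightarrow> real. f v = 0})"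
    using \<sigma> by (intro closed_UN) auto
  then have "closedin ?X ?C"
    by (simp add: geometric_realization_eq closedin_closed_Int)
  moreover have "?U \<subseteq> ?C"
  proof
    fix f assume f: "f \<in> ?U"
    then have "{v. f v \<noteq> 0} \<notin> A" "{v. f v \<noteq> 0} \<in> K"
      by (auto simp: realization_points_def)
    then have "\<not> \<sigma> \<subseteq> {v. f v \<noteq> 0}" using A(2) by blast
    then show "f \<in> ?C" using f by blast
  qed
  ultimately have "?X closure_of ?U \<subseteq> ?C" by (intro closure_of_minimal)
  also have "?C \<subseteq> ?T" using \<sigma> by (auto simp: barycenter_def)
  also have "?T = ?X interior_of ?T"
  proof -
    have "{barycenter \<sigma>} = (\<Inter>v. {f. f v = barycenter \<sigma> v})" by (auto simp: fun_eq_iff)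
    moreover have "closed \<dots>"
      by (intro closed_INT ballI closed_Collect_eq continuous_on_product_coordinates continuous_on_const)
    ultimately have "closed {barycenter \<sigma>}" by simp
    then have "openin ?X ?T"
      unfolding geometric_realization_eq Diff_eq by (intro openin_open_Int) (simp add: open_Compl)
    then show ?thesis by (simp add: interior_of_openin)
  qed
  finally have "?X closure_of ?U \<subseteq> ?X interior_of ?T" .
  from homology_excision_axiom[OF this, of "realization_points K" i]
  have "hom_induced i (subtopology ?X (realization_points K - ?U)) (?T - ?U) (subtopology ?X (realization_points K)) ?T id
    \<in> iso (relative_homology_group i (subtopology ?X (realization_points K - ?U)) (?T - ?U))
          (relative_homology_group i (subtopology ?X (realization_points K)) ?T)" by blast
  moreover have "realization_points K - ?U = realization_points A" "?T - ?U = realization_points A - {barycenter \<sigma>}"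
    using AK by auto
  ultimately show ?thesis
    by (simp add: subtopology_geometric_realization[OF A(1)] subtopology_geometric_realization[OF order_refl])
qed

lemma iso_of_compose:
  assumes "f \<in> hom G H" "g \<in> iso H K" "(\<lambda>x. g (f x)) \<in> iso G K"
  shows "f \<in> iso G H"
proof -
  have g: "bij_betw g (carrier H) (carrier K)" and gf: "bij_betw (\<lambda>x. g (f x)) (carrier G) (carrier K)"
    using assms by (auto simp: iso_def)
  have fH: "f ` carrier G \<subseteq> carrier H" using assms(1) by (auto simp: hom_def)
  have "inj_on f (carrier G)"
    using gf by (auto simp: bij_betw_def inj_on_def)
  moreover have "carrier H \<subseteq> f ` carrier G"
  proof
    fix y assume y: "y \<in> carrier H"
    then obtain x where x: "x \<in> carrier G" "g y = g (f x)"
      using g gf by (metis (no_types, lifting) bij_betw_def image_iff)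
    then have "y = f x" using g y fH by (auto simp: bij_betw_def inj_on_def)
    then show "y \<in> f ` carrier G" using x by blast
  qed
  ultimately show ?thesis using assms(1) fH by (auto simp: iso_def bij_betw_def)
qed

text \<open>In the square comparing complements of open stars with punctured realizations, all maps
  are induced by inclusions, and three are isomorphisms by \<open>punctured_realization_iso\<close>
  and \<open>punctured_realization_excision\<close>.\<close>

lemma star_excision:
  assumes K: "simplicial_complex K" and A: "simplicial_complex A" "A \<subseteq> K"
    and star: "\<And>\<tau>. \<tau> \<in> K \<Longrightarrow> \<sigma> \<subseteq> \<tau> \<Longrightarrow> \<tau> \<in> A"
    and \<sigma>: "finite \<sigma>" "\<sigma> \<noteq> {}"
  shows "pair_map i A (delete_star A \<sigma>) K (delete_star K \<sigma>)
    \<in> iso (pair_homology i A (delete_star A \<sigma>)) (pair_homology i K (delete_star K \<sigma>))"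
proof (rule iso_of_compose[OF pair_map_hom punctured_realization_iso[OF K \<sigma>]])
  let ?b = "barycenter \<sigma>"
  let ?D = "\<lambda>K. realization_points (delete_star K \<sigma>)"
  have D: "?D B \<subseteq> realization_points B - {?b}" for B :: "'a set set"
    using realization_points_mono[OF delete_star_subset] barycenter_not_in_delete_star[OF \<sigma>] by blast
  have DD: "?D A \<subseteq> ?D K"
    using A(2) by (intro realization_points_mono) (auto simp: delete_star_def)
  have AK: "realization_points A \<subseteq> realization_points K" by (rule realization_points_mono[OF A(2)])
  let ?h1 = "hom_induced i (geometric_realization A) (?D A) (geometric_realization A) (realization_points A - {?b}) id"
  let ?h2 = "hom_induced i (geometric_realization A) (realization_points A - {?b})
    (geometric_realization K) (realization_points K - {?b}) id"
  have "?h2 \<circ> ?h1 \<in> iso (pair_homology i A (delete_star A \<sigma>))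
     (relative_homology_group i (geometric_realization K) (realization_points K - {?b}))"
    by (rule iso_set_trans[OF punctured_realization_iso[OF A(1) \<sigma>] punctured_realization_excision[OF K A(2) star \<sigma>]])
  moreover have "?h2 \<circ> ?h1 = (\<lambda>x. hom_induced i (geometric_realization K) (?D K)
        (geometric_realization K) (realization_points K - {?b}) id
         (pair_map i A (delete_star A \<sigma>) K (delete_star K \<sigma>) x))"
    unfolding pair_map_def
    using D[of A] D[of K] DD AK
    by (subst hom_induced_compose'; (subst hom_induced_compose[symmetric])?)
       (auto intro: continuous_map_id_realization[OF A(2)] simp: comp_def)
  ultimately show "(\<lambda>x. hom_induced i (geometric_realization K) (?D K)
        (geometric_realization K) (realization_points K - {?b}) id
         (pair_map i A (delete_star A \<sigma>) K (delete_star K \<sigma>) x))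
    \<in> iso (pair_homology i A (delete_star A \<sigma>))
         (relative_homology_group i (geometric_realization K) (realization_points K - {?b}))"
    by simp
qed

lemma triple_boundary_iso:
  assumes "L \<subseteq> K" "M \<subseteq> L" "trivial_group (pair_homology i K M)" "trivial_group (pair_homology (i - 1) K M)"
  shows "triple_boundary i K L M \<in> iso (pair_homology i K L) (pair_homology (i - 1) L M)"
proof (rule iso_of_exact)
  show "kernel (pair_homology i K L) (pair_homology (i - 1) L M) (triple_boundary i K L M) \<subseteq> {\<one>\<^bsub>pair_homology i K L\<^esub>}"
    using assms(3) hom_one[OF pair_map_hom[of i K M K L]]
    by (simp add: triple_exact_total[OF assms(1,2)] trivial_group_def)
  have "pair_map (i - 1) L M K M x = \<one>\<^bsub>pair_homology (i - 1) K M\<^esub>" for x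
    using pair_map_carrier[of "i - 1" L M K M x] assms(4) by (simp add: trivial_group_def)
  then show "carrier (pair_homology (i - 1) L M) \<subseteq> triple_boundary i K L M ` carrier (pair_homology i K L)"
    using triple_exact_sub[OF assms(1,2), of "i - 1"] unfolding kernel_def diff_add_cancel by blast
qed (use triple_boundary_hom[OF assms(1)] in simp_all)

text \<open>
  The hypotheses say that \<open>K\<close> is a join \<open>\<sigma> * L\<close>, so that \<open>delete_star K \<sigma>\<close> is \<open>\<partial>\<sigma> * L\<close> and \<open>A\<close>
  is \<open>\<sigma>' * L\<close> for the face \<open>\<sigma>'\<close> of \<open>\<sigma>\<close> opposite to \<open>v\<close>. Both \<open>K\<close> and \<open>v * \<partial>\<sigma>' * L\<close> are cones
  with apex \<open>v\<close>, and \<open>\<partial>\<sigma> * L\<close> is the union of the latter and \<open>A\<close>.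
\<close>

lemma pair_homology_drop_vertex:
  assumes K: "simplicial_complex K" and \<sigma>: "\<sigma> \<in> K" "\<And>\<tau>. \<tau> \<in> K \<Longrightarrow> \<tau> \<union> \<sigma> \<in> K"
    and v: "v \<in> \<sigma>" "\<sigma> - {v} \<noteq> {}"
  defines "A \<equiv> {\<tau> \<in> K. v \<notin> \<tau>}"
  shows "pair_homology i K (delete_star K \<sigma>) \<cong> pair_homology (i - 1) A (delete_star A (\<sigma> - {v}))"
proof -
  let ?s = "\<sigma> - {v}" and ?D = "delete_star K \<sigma>" and ?M = "delete_star K (\<sigma> - {v})"
  have fin: "finite \<sigma>" by (rule simplicial_complex_finite[OF K \<sigma>(1)])
  have MD: "?M \<subseteq> ?D" by (auto simp: delete_star_def)
  have DK: "?D \<subseteq> K" by (rule delete_star_subset)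
  have vK: "insert v \<tau> \<in> K" if "\<tau> \<in> K" for \<tau>
  proof -
    have "insert v \<tau> \<subseteq> \<tau> \<union> \<sigma>" using v by blast
    then show ?thesis using simplicial_complex_face[OF K \<sigma>(2)[OF that]] by simp
  qed
  have vv: "{v} \<in> K" using simplicial_complex_face[OF K \<sigma>(1), of "{v}"] v(1) by simp
  \<comment> \<open>Adding \<open>v\<close> to a simplex does not affect whether it contains
    \<open>\<sigma> - {v}\<close>, so \<open>?M\<close> is a cone with apex \<open>v\<close> just as
    \<open>K\<close> is.\<close>
  have triv: "trivial_group (pair_homology j K ?M)" for j
  proof (rule trivial_pair_homology_cone[OF K _ _ _ vK])
    show "simplicial_complex ?M" by (rule simplicial_complex_delete_star[OF K])
    show "{v} \<in> ?M" using vv v(2) by (auto simp: delete_star_def)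
    show "insert v \<tau> \<in> ?M" if "\<tau> \<in> ?M" for \<tau>
      using that vK by (auto simp: delete_star_def)
  qed (rule delete_star_subset)
  have 1: "pair_homology i K ?D \<cong> pair_homology (i - 1) ?D ?M"
    using triple_boundary_iso[OF DK MD triv triv, of i] by (auto simp: is_iso_def)
  have A: "simplicial_complex A" using K unfolding A_def simplicial_complex_def by blast
  have AD: "A \<subseteq> ?D" using v(1) by (auto simp: A_def delete_star_def)
  \<comment> \<open>A simplex of \<open>?D\<close> containing \<open>?s\<close> cannot contain
    \<open>v\<close> as well, since it would then contain \<open>\<sigma>\<close>; hence
    \<open>A\<close> holds the whole open star of \<open>?s\<close> in \<open>?D\<close>.\<close>
  have "\<tau> \<in> A" if "\<tau> \<in> ?D" "?s \<subseteq> \<tau>" for \<tau>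
    using that v(1) by (auto simp: A_def delete_star_def)
  moreover have "delete_star ?D ?s = ?M" by (auto simp: delete_star_def)
  ultimately have "pair_homology (i - 1) A (delete_star A ?s) \<cong> pair_homology (i - 1) ?D ?M"
    using star_excision[OF simplicial_complex_delete_star[OF K] A AD, of ?s "i - 1"] fin v(2)
    by (auto simp: is_iso_def)
  then show ?thesis using 1 by (metis group.iso_sym group_pair_homology iso_trans)
qed

text \<open>Iterates \<open>pair_homology_drop_vertex\<close>, each vertex lowering the degree by
  one. As \<open>\<rho>\<close> is a proper subset, every intermediate face is nonempty.\<close>

lemma pair_homology_drop_simplex:
  assumes K: "simplicial_complex K" and \<sigma>: "\<sigma> \<in> K" "\<And>\<tau>. \<tau> \<in> K \<Longrightarrow> \<tau> \<union> \<sigma> \<in> K"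
    and \<rho>: "\<rho> \<subset> \<sigma>"
  shows "pair_homology i K (delete_star K \<sigma>)
    \<cong> pair_homology (i - int (card \<rho>)) {\<tau> \<in> K. \<tau> \<inter> \<rho> = {}} (delete_star {\<tau> \<in> K. \<tau> \<inter> \<rho> = {}} (\<sigma> - \<rho>))"
proof -
  have "finite \<rho>" using simplicial_complex_finite[OF K \<sigma>(1)] \<rho> by (meson finite_subset psubset_imp_subset)
  then show ?thesis using K \<sigma> \<rho>
  proof (induction \<rho> arbitrary: K \<sigma> i rule: finite_induct)
    case empty
    then show ?case by (simp add: iso_refl)
  next
    case (insert v \<rho>)
    let ?A = "{\<tau> \<in> K. v \<notin> \<tau>}"
    have ne: "\<sigma> - {v} \<noteq> {}" using insert.prems(4) by blast
    have A: "simplicial_complex ?A" using insert.prems(1) unfolding simplicial_complex_def by blast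
    have "\<sigma> - {v} \<in> ?A" using ne simplicial_complex_face[OF insert.prems(1,2), of "\<sigma> - {v}"] by simp
    moreover have "\<tau> \<union> (\<sigma> - {v}) \<in> ?A" if "\<tau> \<in> ?A" for \<tau>
    proof -
      have "\<tau> \<union> \<sigma> \<in> K" "\<tau> \<union> (\<sigma> - {v}) \<subseteq> \<tau> \<union> \<sigma>" using that insert.prems(3) by auto
      from simplicial_complex_face[OF insert.prems(1) this] ne
      have "\<tau> \<union> (\<sigma> - {v}) \<in> K" by blast
      then show ?thesis using that by simp
    qed
    ultimately have IH: "pair_homology (i - 1) ?A (delete_star ?A (\<sigma> - {v}))
      \<cong> pair_homology (i - 1 - int (card \<rho>)) {\<tau> \<in> ?A. \<tau> \<inter> \<rho> = {}} (delete_star {\<tau> \<in> ?A. \<tau> \<inter> \<rho> = {}} (\<sigma> - {v} - \<rho>))"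
      using insert.prems(4) insert.hyps(2) by (intro insert.IH A) auto
    have e1: "{\<tau> \<in> ?A. \<tau> \<inter> \<rho> = {}} = {\<tau> \<in> K. \<tau> \<inter> insert v \<rho> = {}}" by auto
    have e2: "\<sigma> - {v} - \<rho> = \<sigma> - insert v \<rho>" by blast
    have e3: "i - 1 - int (card \<rho>) = i - int (card (insert v \<rho>))"
      using insert.hyps by simp
    have "pair_homology i K (delete_star K \<sigma>) \<cong> pair_homology (i - 1) ?A (delete_star ?A (\<sigma> - {v}))"
      using insert.prems(4) ne by (intro pair_homology_drop_vertex insert.prems) auto
    from iso_trans[OF this IH] show ?case unfolding e1 e2 e3 .
  qed
qed

section \<open>Interval complexes\<close>

definition intervals :: "'a::order set \<Rightarrow> ('a \<times> 'a) set"
  where "intervals P = {(x, y). x \<in> P \<and> y \<in> P \<and> x \<le> y}"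

text \<open>An order ideal in the poset of intervals ordered by inclusion.\<close>

definition interval_ideal :: "'a::order set \<Rightarrow> ('a \<times> 'a) set \<Rightarrow> bool"
  where "interval_ideal P Q \<longleftrightarrow> Q \<subseteq> intervals P \<and>
    (\<forall>a b a' b'. (a, b) \<in> Q \<and> (a', b') \<in> intervals P \<and> a \<le> a' \<and> b' \<le> b \<longrightarrow> (a', b') \<in> Q)"

definition maximal_interval :: "('a::order \<times> 'a) set \<Rightarrow> 'a \<Rightarrow> 'a \<Rightarrow> bool"
  where "maximal_interval Q x y \<longleftrightarrow> (x, y) \<in> Q \<and>
    (\<forall>a b. (a, b) \<in> Q \<and> a \<le> x \<and> y \<le> b \<longrightarrow> a = x \<and> b = y)"

text \<open>The pair \<open>(a, b)\<close> is the hull of the chain \<open>C\<close>. Ideals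
  \<open>Q\<close> thus index the subcomplexes of a cell structure with one cell for each
  interval.\<close>

definition interval_complex :: "'a::order set \<Rightarrow> ('a \<times> 'a) set \<Rightarrow> 'a set set"
  where "interval_complex P Q =
    {C \<in> order_complex P. \<exists>a\<in>C. \<exists>b\<in>C. (\<forall>z\<in>C. a \<le> z \<and> z \<le> b) \<and> (a, b) \<in> Q}"

lemma chain_in_iff:
  "pred_on.chain P (\<le>) C \<longleftrightarrow> C \<subseteq> P \<and> (\<forall>x\<in>C. \<forall>y\<in>C. x \<le> y \<or> y \<le> x)" for P :: "'a::order set"
  by (auto simp: pred_on.chain_def)

lemma order_complex_iff:
  "C \<in> order_complex P \<longleftrightarrow> C \<subseteq> P \<and> (\<forall>x\<in>C. \<forall>y\<in>C. x \<le> y \<or> y \<le> x) \<and> finite C \<and> C \<noteq> {}"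
  by (auto simp: order_complex_def chain_in_iff)

lemma finite_chain_endpoints:
  fixes C :: "'a::order set"
  assumes "finite C" "C \<noteq> {}" "\<forall>x\<in>C. \<forall>y\<in>C. x \<le> y \<or> y \<le> x"
  obtains a b where "a \<in> C" "b \<in> C" "\<And>z. z \<in> C \<Longrightarrow> a \<le> z" "\<And>z. z \<in> C \<Longrightarrow> z \<le> b"
proof -
  obtain a where a: "a \<in> C" "\<forall>z\<in>C. z \<le> a \<longrightarrow> a = z"
    using finite_has_minimal[OF assms(1,2)] by blast
  obtain b where b: "b \<in> C" "\<forall>z\<in>C. b \<le> z \<longrightarrow> b = z"
    using finite_has_maximal[OF assms(1,2)] by blast
  show thesis
  proof
    show "a \<in> C" "b \<in> C" by fact+
    show "a \<le> z" "z \<le> b" if "z \<in> C" for z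
      using a b assms(3) that by (metis order_refl)+
  qed
qed

text \<open>The hull of a face is contained in the hull of the chain, so it stays in the
  ideal.\<close>

lemma simplicial_complex_interval_complex:
  assumes "interval_ideal P Q"
  shows "simplicial_complex (interval_complex P Q)"
  unfolding simplicial_complex_def
proof (intro ballI conjI allI impI)
  fix C assume C: "C \<in> interval_complex P Q"
  then have CP: "C \<subseteq> P" "\<forall>x\<in>C. \<forall>y\<in>C. x \<le> y \<or> y \<le> x" "finite C" "C \<noteq> {}"
    by (auto simp: interval_complex_def order_complex_iff)
  then show "finite C" "C \<noteq> {}" by simp_all
  obtain a b where ab: "\<And>z. z \<in> C \<Longrightarrow> a \<le> z \<and> z \<le> b" "(a, b) \<in> Q"
    using C by (auto simp: interval_complex_def)
  fix D assume D: "D \<subseteq> C \<and> D \<noteq> {}"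
  then have ch: "finite D" "D \<noteq> {}" "\<forall>x\<in>D. \<forall>y\<in>D. x \<le> y \<or> y \<le> x" "D \<subseteq> P"
    using CP finite_subset by blast+
  obtain c d where cd: "c \<in> D" "d \<in> D" "\<And>z. z \<in> D \<Longrightarrow> c \<le> z" "\<And>z. z \<in> D \<Longrightarrow> z \<le> d"
    using finite_chain_endpoints[OF ch(1-3)] by blast
  have "(c, d) \<in> intervals P" using cd ch by (auto simp: intervals_def)
  moreover have "a \<le> c" "d \<le> b" using ab cd D by blast+
  ultimately have "(c, d) \<in> Q"
    using assms ab(2) unfolding interval_ideal_def by blast
  then have "\<exists>a\<in>D. \<exists>b\<in>D. (\<forall>z\<in>D. a \<le> z \<and> z \<le> b) \<and> (a, b) \<in> Q"
    using cd by blast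
  then show "D \<in> interval_complex P Q"
    using ch unfolding interval_complex_def order_complex_iff by blast
qed

lemma interval_ideal_intervals: "interval_ideal P (intervals P)"
  by (auto simp: interval_ideal_def)

lemma interval_complex_intervals: "interval_complex P (intervals P) = order_complex P"
proof
  show "order_complex P \<subseteq> interval_complex P (intervals P)"
  proof
    fix C assume C: "C \<in> order_complex P"
    then obtain a b where "a \<in> C" "b \<in> C" "\<And>z. z \<in> C \<Longrightarrow> a \<le> z" "\<And>z. z \<in> C \<Longrightarrow> z \<le> b"
      using finite_chain_endpoints[of C] by (metis order_complex_iff)
    then show "C \<in> interval_complex P (intervals P)"
      using C unfolding interval_complex_def intervals_def order_complex_iff by blast
  qed
qed (auto simp: interval_complex_def)

lemma interval_complex_mono: "Q' \<subseteq> Q \<Longrightarrow> interval_complex P Q' \<subseteq> interval_complex P Q"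
  unfolding interval_complex_def by blast

lemma interval_complex_empty [simp]: "interval_complex P {} = {}"
  by (simp add: interval_complex_def)

lemma interval_ideal_remove_maximal:
  assumes "interval_ideal P Q" "maximal_interval Q x y"
  shows "interval_ideal P (Q - {(x, y)})"
  unfolding interval_ideal_def
proof (intro conjI allI impI)
  show "Q - {(x, y)} \<subseteq> intervals P" using assms(1) by (auto simp: interval_ideal_def)
  fix a b a' b'
  assume h: "(a, b) \<in> Q - {(x, y)} \<and> (a', b') \<in> intervals P \<and> a \<le> a' \<and> b' \<le> b"
  then have "(a', b') \<in> Q" using assms(1) unfolding interval_ideal_def by blast
  moreover have "(a', b') \<noteq> (x, y)" using h assms(2) unfolding maximal_interval_def by blast
  ultimately show "(a', b') \<in> Q - {(x, y)}" by blast
qed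

text \<open>A chain containing \<open>x\<close> and \<open>y\<close> has a hull around
  \<open>[x, y]\<close>, which by maximality is \<open>[x, y]\<close> itself. So dropping a maximal
  interval deletes one open star, and star excision becomes available.\<close>

lemma delete_star_interval_complex:
  assumes "maximal_interval Q x y"
  shows "delete_star (interval_complex P Q) {x, y} = interval_complex P (Q - {(x, y)})"
proof -
  have "\<not> {x, y} \<subseteq> C \<longleftrightarrow> (a, b) \<noteq> (x, y)"
    if "(a, b) \<in> Q" "a \<in> C" "b \<in> C" "\<forall>z\<in>C. a \<le> z \<and> z \<le> b" for C a b
    using that assms unfolding maximal_interval_def by blast
  then show ?thesis
    unfolding delete_star_def interval_complex_def by blast
qed

text \<open>The open star of \<open>{x, y}\<close> consists of the chains with hull
  \<open>[x, y]\<close>, the same in both complexes. The relative homology of a cell hence does not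
  depend on the ideal it is attached to.\<close>

lemma interval_complex_excision:
  assumes "interval_ideal P Q" "interval_ideal P Q'" "Q' \<subseteq> Q" "maximal_interval Q x y" "(x, y) \<in> Q'"
  shows "pair_map i (interval_complex P Q') (interval_complex P (Q' - {(x, y)}))
      (interval_complex P Q) (interval_complex P (Q - {(x, y)}))
    \<in> iso (pair_homology i (interval_complex P Q') (interval_complex P (Q' - {(x, y)})))
       (pair_homology i (interval_complex P Q) (interval_complex P (Q - {(x, y)})))"
proof -
  have mx': "maximal_interval Q' x y"
    using assms(3-5) unfolding maximal_interval_def by blast
  have "\<tau> \<in> interval_complex P Q'" if \<tau>: "\<tau> \<in> interval_complex P Q" "{x, y} \<subseteq> \<tau>" for \<tau>
  proof -
    obtain a b where ab: "a \<in> \<tau>" "b \<in> \<tau>" "\<forall>z\<in>\<tau>. a \<le> z \<and> z \<le> b" "(a, b) \<in> Q"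
      using \<tau>(1) by (auto simp: interval_complex_def)
    then have "a = x \<and> b = y" using assms(4) \<tau>(2) unfolding maximal_interval_def by blast
    then show ?thesis using ab \<tau>(1) assms(5) unfolding interval_complex_def by blast
  qed
  from star_excision[OF simplicial_complex_interval_complex[OF assms(1)]
      simplicial_complex_interval_complex[OF assms(2)] interval_complex_mono[OF assms(3)], of "{x, y}" i, OF this]
  show ?thesis
    by (simp add: delete_star_interval_complex[OF assms(4)] delete_star_interval_complex[OF mx'])
qed

section \<open>Maximal chains and ranks\<close>

lemma extend_to_maxchain:
  fixes P :: "'a::order set"
  assumes "finite P" "pred_on.chain P (\<le>) D"
  obtains C where "pred_on.maxchain P (\<le>) C" "D \<subseteq> C"
proof -
  let ?S = "{C. pred_on.chain P (\<le>) C \<and> D \<subseteq> C}"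
  have "?S \<subseteq> Pow P" by (auto simp: pred_on.chain_def)
  then have "finite ?S" using assms(1) by (meson finite_Pow_iff finite_subset)
  moreover have "?S \<noteq> {}" using assms(2) by blast
  ultimately obtain C where C: "C \<in> ?S" "\<forall>B\<in>?S. C \<subseteq> B \<longrightarrow> C = B"
    using finite_has_maximal[of ?S] by auto
  then have "pred_on.maxchain P (\<le>) C"
    unfolding pred_on.maxchain_def by blast
  then show thesis using C that by blast
qed

lemma maxchain_insert:
  fixes P :: "'a::order set"
  assumes "pred_on.maxchain P (\<le>) C" "z \<in> P" "\<And>u. u \<in> C \<Longrightarrow> u \<le> z \<or> z \<le> u"
  shows "z \<in> C"
proof (rule ccontr)
  assume "z \<notin> C"
  have "pred_on.chain P (\<le>) (insert z C)"
    using assms unfolding pred_on.maxchain_def chain_in_iff by blast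
  then show False
    using assms(1) \<open>z \<notin> C\<close> unfolding pred_on.maxchain_def by blast
qed

locale graded_poset =
  fixes P :: "'a::order set" and m :: nat and r :: "'a \<Rightarrow> nat"
  assumes graded: "finite_graded_poset P m r"
begin

lemma finite_P: "finite P"
  using graded by (simp add: finite_graded_poset_def)

lemma maxchainD:
  assumes "pred_on.maxchain P (\<le>) C"
  shows "C \<subseteq> P" "finite C" "card C = m + 1" "\<And>x y. x \<in> C \<Longrightarrow> y \<in> C \<Longrightarrow> x \<le> y \<or> y \<le> x"
proof -
  have "pred_on.chain P (\<le>) C" using assms by (simp add: pred_on.maxchain_def)
  then show "C \<subseteq> P" "\<And>x y. x \<in> C \<Longrightarrow> y \<in> C \<Longrightarrow> x \<le> y \<or> y \<le> x" by (auto simp: chain_in_iff)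
  then show "finite C" using finite_P finite_subset by blast
  show "card C = m + 1" using graded assms by (simp add: finite_graded_poset_def)
qed

text \<open>The least element of a maximal chain is minimal in \<open>P\<close>, and consecutive
  elements are covers, since anything missing could be inserted; so the rank counts the steps up the
  chain.\<close>

lemma rank_eq_card_below:
  assumes C: "pred_on.maxchain P (\<le>) C" and "z \<in> C"
  shows "r z = card {u \<in> C. u < z}"
  using \<open>z \<in> C\<close>
proof (induction "card {u \<in> C. u < z}" arbitrary: z rule: less_induct)
  case less
  note CD = maxchainD[OF C]
  let ?B = "{u \<in> C. u < z}"
  have fB: "finite ?B" using CD by simp
  show ?case
  proof (cases "?B = {}")
    case True
    have "minimal_in P z"
      unfolding minimal_in_def
    proof (intro conjI notI)
      show "z \<in> P" using less.prems CD by blast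
      assume "\<exists>y\<in>P. y < z"
      then obtain y where y: "y \<in> P" "y < z" by blast
      have "z \<le> u" if "u \<in> C" for u
        using True CD(4)[OF less.prems that] that by auto
      then have "y \<in> C" using y by (intro maxchain_insert[OF C]) (auto intro: less_imp_le order_trans)
      then show False using True y by blast
    qed
    then have "r z = 0" using graded by (simp add: finite_graded_poset_def)
    then show ?thesis using True by (simp only: card.empty)
  next
    case False
    \<comment> \<open>\<open>u\<close> is the predecessor of \<open>z\<close> in the chain.\<close>
    obtain u where u: "u \<in> ?B" "\<And>w. w \<in> ?B \<Longrightarrow> w \<le> u"
      using finite_chain_endpoints[OF fB False] CD(4) by (metis (no_types, lifting) mem_Collect_eq)
    have B: "?B = insert u {w \<in> C. w < u}"
      using u by (auto simp: less_le)
    then have card: "card ?B = card {w \<in> C. w < u} + 1" using CD by simp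
    have "covers_in P z u"
      unfolding covers_in_def
    proof (intro conjI notI)
      show "u \<in> P" "z \<in> P" "u < z" using u less.prems CD by auto
      assume "\<exists>w\<in>P. u < w \<and> w < z"
      then obtain w where w: "w \<in> P" "u < w" "w < z" by blast
      \<comment> \<open>An element \<open>w\<close> strictly between would be comparable with the
        whole chain, hence in it, against the choice of \<open>u\<close>.\<close>
      have "v \<le> w \<or> w \<le> v" if "v \<in> C" for v
      proof (cases "v < z")
        case True
        then have "v \<le> u" using u that by simp
        then show ?thesis using w by auto
      next
        case False
        then have "z \<le> v" using CD(4)[OF less.prems that] by auto
        then show ?thesis using w by auto
      qed
      then have "w \<in> C" by (rule maxchain_insert[OF C w(1)])
      then have "w \<le> u" using u(2) w(3) by simp
      then show False using w(2) by simp
    qed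
    then have "r z = r u + 1" using graded by (simp add: finite_graded_poset_def)
    moreover have "r u = card {w \<in> C. w < u}"
      using u card by (intro less.hyps) auto
    ultimately show ?thesis using card by simp
  qed
qed

lemma maxchain_through:
  assumes "(x, y) \<in> intervals P"
  obtains C where "pred_on.maxchain P (\<le>) C" "x \<in> C" "y \<in> C"
proof (rule extend_to_maxchain[OF finite_P])
  show "pred_on.chain P (\<le>) {x, y}" using assms by (auto simp: chain_in_iff intervals_def)
qed (use that in blast)

lemma rank_strict_mono:
  assumes "x \<in> P" "y \<in> P" "x < y"
  shows "r x < r y"
proof -
  obtain C where C: "pred_on.maxchain P (\<le>) C" "x \<in> C" "y \<in> C"
    using maxchain_through[of x y] assms less_imp_le unfolding intervals_def by blast
  have "{u \<in> C. u < x} \<subset> {u \<in> C. u < y}" using C assms(3) by (auto intro: less_trans)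
  then show ?thesis
    using C maxchainD(2)[OF C(1)] by (simp add: rank_eq_card_below psubset_card_mono)
qed

lemma rank_le: "z \<in> P \<Longrightarrow> r z \<le> m"
proof -
  assume "z \<in> P"
  then obtain C where C: "pred_on.maxchain P (\<le>) C" "z \<in> C"
    using maxchain_through[of z z] unfolding intervals_def by blast
  have "{u \<in> C. u < z} \<subset> C" using C by auto
  then have "card {u \<in> C. u < z} < card C"
    using maxchainD(2)[OF C(1)] by (simp add: psubset_card_mono)
  then show "r z \<le> m" using rank_eq_card_below[OF C] maxchainD(3)[OF C(1)] by simp
qed

lemma maxchain_rank_bij:
  assumes "pred_on.maxchain P (\<le>) C"
  shows "bij_betw r C {..m}"
proof -
  note CD = maxchainD[OF assms]
  have inj: "inj_on r C"
  proof (rule inj_onI, rule ccontr)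
    fix x y assume "x \<in> C" "y \<in> C" "r x = r y" "x \<noteq> y"
    then show False using CD(4)[of x y] rank_strict_mono[of x y] rank_strict_mono[of y x] CD(1)
      by (auto simp: less_le subset_iff)
  qed
  moreover have "r ` C \<subseteq> {..m}" using CD(1) rank_le by auto
  moreover have "card (r ` C) = card {..m}" using card_image[OF inj] CD(3) by simp
  ultimately show ?thesis by (simp add: bij_betw_def card_subset_eq)
qed

lemma ex_maxchain: obtains C where "pred_on.maxchain P (\<le>) C"
  by (rule extend_to_maxchain[OF finite_P, of "{}"]) (auto simp: chain_in_iff)

text \<open>The dimension of the cell belonging to an interval, as an integer because homology is
  graded by integers.\<close>

definition length_of :: "'a \<times> 'a \<Rightarrow> int"
  where "length_of p = int (r (snd p)) - int (r (fst p))"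

text \<open>Of the \<open>m + 1\<close> elements of the chain, \<open>r y - r x + 1\<close> lie
  between \<open>x\<close> and \<open>y\<close>, by \<open>rank_eq_card_below\<close>.\<close>

lemma card_maxchain_outside:
  assumes C: "pred_on.maxchain P (\<le>) C" "x \<in> C" "y \<in> C" "x \<le> y"
  shows "int (card {z \<in> C. z < x \<or> y < z}) = int m - length_of (x, y)"
proof -
  note CD = maxchainD[OF C(1)]
  let ?O = "{z \<in> C. z < x \<or> y < z}"
  \<comment> \<open>The difference of the two lower sets runs from \<open>x\<close> up to but
    excluding \<open>y\<close>; hence the inserted \<open>y\<close>.\<close>
  have "C = ?O \<union> insert y ({u \<in> C. u < y} - {u \<in> C. u < x})"
  proof -
    have "z \<in> ?O \<or> z = y \<or> z < y \<and> \<not> z < x" if "z \<in> C" for z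
      using CD(4)[OF C(3) that] that by (auto simp: less_le)
    then show ?thesis using C by blast
  qed
  moreover have "?O \<inter> insert y ({u \<in> C. u < y} - {u \<in> C. u < x}) = {}"
    using C(4) by auto
  ultimately have "card C = card ?O + card (insert y ({u \<in> C. u < y} - {u \<in> C. u < x}))"
    using CD(2) by (metis (no_types, lifting) card_Un_disjoint finite_Un)
  moreover have "card (insert y ({u \<in> C. u < y} - {u \<in> C. u < x})) = Suc (r y - r x)"
  proof -
    have "{u \<in> C. u < x} \<subseteq> {u \<in> C. u < y}" using C(4) by auto
    then have "card ({u \<in> C. u < y} - {u \<in> C. u < x}) = r y - r x"
      using CD(2) C by (simp add: rank_eq_card_below card_Diff_subset)
    then show ?thesis using CD(2) by simp
  qed
  moreover have "r x \<le> r y"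
    using C CD(1) rank_strict_mono[of x y] by (cases "x = y") (auto simp: less_le subset_iff)
  ultimately show ?thesis using CD(3) by (simp add: length_of_def)
qed

end

section \<open>Local homology of intervals\<close>

lemma homology_manifold_homeomorphic:
  assumes "homology_manifold n X" "Y homeomorphic_space X"
  shows "homology_manifold n Y"
  unfolding homology_manifold_def
proof (intro ballI allI)
  obtain h where h: "homeomorphic_map Y X h"
    using assms(2) unfolding homeomorphic_space by (elim exE)
  fix y i assume y: "y \<in> topspace Y"
  have im: "h ` topspace Y = topspace X" and inj: "inj_on h (topspace Y)"
    using h by (simp_all add: homeomorphic_eq_everything_map)
  have "h ` (topspace Y - {y}) = topspace X - {h y}"
    using y by (simp add: inj_on_image_set_diff[OF inj] im)
  from homeomorphic_map_relative_homology_iso[OF h Diff_subset this]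
  have iso: "relative_homology_group i Y (topspace Y - {y}) \<cong> relative_homology_group i X (topspace X - {h y})"
    by (auto simp: is_iso_def)
  have "h y \<in> topspace X" using y im by blast
  then have "(i \<noteq> int n \<longrightarrow> trivial_group (relative_homology_group i X (topspace X - {h y}))) \<and>
       (i = int n \<longrightarrow> relative_homology_group i X (topspace X - {h y}) \<cong> integer_group)"
    using assms(1) unfolding homology_manifold_def by blast
  then show "(i \<noteq> int n \<longrightarrow> trivial_group (relative_homology_group i Y (topspace Y - {y}))) \<and>
       (i = int n \<longrightarrow> relative_homology_group i Y (topspace Y - {y}) \<cong> integer_group)"
    using isomorphic_group_triviality[OF iso group_relative_homology_group group_relative_homology_group]
      iso_trans[OF iso] by blast
qed

text \<open>The local homology is taken at the barycenter of \<open>\<sigma>\<close>;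
  \<open>punctured_realization_iso\<close> turns it into the homology of a pair of
  complexes.\<close>

lemma homology_manifold_star:
  assumes K: "simplicial_complex K" and man: "homology_manifold n (geometric_realization K)" and \<sigma>: "\<sigma> \<in> K"
  shows "i \<noteq> int n \<Longrightarrow> trivial_group (pair_homology i K (delete_star K \<sigma>))"
    and "i = int n \<Longrightarrow> pair_homology i K (delete_star K \<sigma>) \<cong> integer_group"
proof -
  have fin: "finite \<sigma>" "\<sigma> \<noteq> {}" using K \<sigma> unfolding simplicial_complex_def by blast+
  have top: "topspace (geometric_realization K) = realization_points K"
    by (simp add: geometric_realization_eq)
  let ?G = "relative_homology_group i (geometric_realization K) (realization_points K - {barycenter \<sigma>})"
  have iso: "pair_homology i K (delete_star K \<sigma>) \<cong> ?G"
    using punctured_realization_iso[OF K fin] unfolding is_iso_def by blast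
  have "(i \<noteq> int n \<longrightarrow> trivial_group ?G) \<and> (i = int n \<longrightarrow> ?G \<cong> integer_group)"
    using man barycenter_in_realization[OF \<sigma> fin] unfolding homology_manifold_def top by blast
  then show "i \<noteq> int n \<Longrightarrow> trivial_group (pair_homology i K (delete_star K \<sigma>))"
    "i = int n \<Longrightarrow> pair_homology i K (delete_star K \<sigma>) \<cong> integer_group"
    using isomorphic_group_triviality[OF iso group_pair_homology group_relative_homology_group]
      iso_trans[OF iso] by blast+
qed

lemma nontrivial_group_of_iso_integers:
  assumes "G \<cong> integer_group"
  shows "\<not> trivial_group G"
proof
  assume "trivial_group G"
  then have "trivial_group integer_group"
    using isomorphic_group_triviality1[OF assms group_integer_group] by blast
  moreover have "(UNIV :: int set) \<noteq> {0}" by (metis UNIV_I one_neq_zero singletonD)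
  ultimately show False by (simp add: trivial_group_def)
qed

text \<open>For \<open>(x, y)\<close> in \<open>intervals P\<close> this is the principal ideal
  generated by \<open>(x, y)\<close>; its complex is the order complex of
  \<open>[x, y]\<close>.\<close>

definition intervals_within :: "'a::order set \<Rightarrow> 'a \<Rightarrow> 'a \<Rightarrow> ('a \<times> 'a) set"
  where "intervals_within P x y = {(a, b) \<in> intervals P. x \<le> a \<and> b \<le> y}"

lemma interval_ideal_intervals_within: "interval_ideal P (intervals_within P x y)"
  unfolding interval_ideal_def intervals_within_def by (auto intro: order_trans)

lemma maximal_interval_intervals_within:
  "(x, y) \<in> intervals P \<Longrightarrow> maximal_interval (intervals_within P x y) x y"
  unfolding maximal_interval_def intervals_within_def by auto

lemma intervals_within_subset:
  assumes "interval_ideal P Q" "(x, y) \<in> Q"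
  shows "intervals_within P x y \<subseteq> Q"
  using assms unfolding interval_ideal_def intervals_within_def by blast

lemma simplicial_complex_order_complex: "simplicial_complex (order_complex P)"
  using simplicial_complex_interval_complex[OF interval_ideal_intervals[of P]]
  by (simp add: interval_complex_intervals)

lemma interval_complex_intervals_within:
  "interval_complex P (intervals_within P x y) = {C \<in> order_complex P. \<forall>z\<in>C. x \<le> z \<and> z \<le> y}"
proof (intro equalityI subsetI)
  fix C assume "C \<in> interval_complex P (intervals_within P x y)"
  then obtain a b where "C \<in> order_complex P" "\<forall>z\<in>C. a \<le> z \<and> z \<le> b" "x \<le> a" "b \<le> y"
    unfolding interval_complex_def intervals_within_def by blast
  then show "C \<in> {C \<in> order_complex P. \<forall>z\<in>C. x \<le> z \<and> z \<le> y}"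
    by (blast intro: order_trans)
next
  fix C assume C: "C \<in> {C \<in> order_complex P. \<forall>z\<in>C. x \<le> z \<and> z \<le> y}"
  then have "C \<in> interval_complex P (intervals P)" by (simp add: interval_complex_intervals)
  then obtain a b where "a \<in> C" "b \<in> C" "\<forall>z\<in>C. a \<le> z \<and> z \<le> b" "(a, b) \<in> intervals P"
    unfolding interval_complex_def by blast
  then have "\<exists>a\<in>C. \<exists>b\<in>C. (\<forall>z\<in>C. a \<le> z \<and> z \<le> b) \<and> (a, b) \<in> intervals_within P x y"
    using C unfolding intervals_within_def by blast
  then show "C \<in> interval_complex P (intervals_within P x y)"
    using C unfolding interval_complex_def by blast
qed

context graded_poset
begin

text \<open>Star excision passes from the order complex to the closed star of
  \<open>\<sigma>\<close>. Dropping the vertices \<open>\<rho>\<close> there leaves the chains in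
  \<open>[x, y]\<close> and lowers the degree by \<open>card \<rho>\<close>, which is
  \<open>m\<close> minus the length.\<close>

lemma interval_homology_iso_star:
  assumes xy: "(x, y) \<in> intervals P"
  obtains \<sigma> where "\<sigma> \<in> order_complex P"
    "\<And>i. pair_homology i (interval_complex P (intervals_within P x y))
        (interval_complex P (intervals_within P x y - {(x, y)}))
      \<cong> pair_homology (i + int m - length_of (x, y)) (order_complex P) (delete_star (order_complex P) \<sigma>)"
proof -
  let ?K = "order_complex P"
  obtain C where C: "pred_on.maxchain P (\<le>) C" "x \<in> C" "y \<in> C"
    using maxchain_through[OF xy] by blast
  note CD = maxchainD[OF C(1)]
  have xy': "x \<le> y" using xy by (simp add: intervals_def)
  define \<rho> where "\<rho> = {z \<in> C. z < x \<or> y < z}"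
  define \<sigma> where "\<sigma> = insert x (insert y \<rho>)"
  have \<sigma>C: "\<sigma> \<subseteq> C" using C by (auto simp: \<sigma>_def \<rho>_def)
  have \<sigma>: "\<sigma> \<in> ?K"
    using \<sigma>C CD finite_subset[OF \<sigma>C] by (auto simp: order_complex_iff \<sigma>_def)
  have fin: "finite \<sigma>" "\<sigma> \<noteq> {}" using \<sigma> by (auto simp: order_complex_iff)
  \<comment> \<open>The closed star of \<open>\<sigma>\<close>, which is a join with
    \<open>\<sigma>\<close>.\<close>
  define A where "A = {\<tau> \<in> ?K. \<tau> \<union> \<sigma> \<in> ?K}"
  have face: "\<tau> \<in> ?K" if "\<upsilon> \<in> ?K" "\<tau> \<subseteq> \<upsilon>" "\<tau> \<noteq> {}" for \<tau> \<upsilon>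
    using simplicial_complex_face[OF simplicial_complex_order_complex that] .
  have A: "simplicial_complex A"
    unfolding simplicial_complex_def
  proof (intro ballI conjI allI impI)
    fix \<tau> assume \<tau>: "\<tau> \<in> A"
    then show "finite \<tau>" "\<tau> \<noteq> {}" by (auto simp: A_def order_complex_iff)
    fix \<upsilon> assume "\<upsilon> \<subseteq> \<tau> \<and> \<upsilon> \<noteq> {}"
    then show "\<upsilon> \<in> A"
      using \<tau> face[of \<tau> \<upsilon>] face[of "\<tau> \<union> \<sigma>" "\<upsilon> \<union> \<sigma>"] by (auto simp: A_def)
  qed
  have star: "\<tau> \<in> A" if "\<tau> \<in> ?K" "\<sigma> \<subseteq> \<tau>" for \<tau>
    using that by (auto simp: A_def sup_absorb1)
  have 1: "pair_homology i A (delete_star A \<sigma>) \<cong> pair_homology i ?K (delete_star ?K \<sigma>)" for i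
    using star_excision[OF simplicial_complex_order_complex A _ star fin, where i = i]
    by (auto simp: is_iso_def A_def)
  have "\<sigma> \<in> A" using \<sigma> by (simp add: A_def)
  moreover have "\<tau> \<union> \<sigma> \<in> A" if "\<tau> \<in> A" for \<tau> using that by (simp add: A_def)
  moreover have "\<rho> \<subset> \<sigma>" using xy' by (auto simp: \<sigma>_def \<rho>_def)
  ultimately have 2: "pair_homology i A (delete_star A \<sigma>)
    \<cong> pair_homology (i - int (card \<rho>)) {\<tau> \<in> A. \<tau> \<inter> \<rho> = {}} (delete_star {\<tau> \<in> A. \<tau> \<inter> \<rho> = {}} (\<sigma> - \<rho>))" for i
    by (rule pair_homology_drop_simplex[OF A])
  have "\<sigma> - \<rho> = {x, y}" using xy' by (auto simp: \<sigma>_def \<rho>_def)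
  moreover have "{\<tau> \<in> A. \<tau> \<inter> \<rho> = {}} = interval_complex P (intervals_within P x y)"
    unfolding interval_complex_intervals_within
  proof (intro equalityI subsetI)
    fix \<tau> assume "\<tau> \<in> {\<tau> \<in> A. \<tau> \<inter> \<rho> = {}}"
    then have \<tau>: "\<tau> \<in> ?K" "\<tau> \<union> \<sigma> \<in> ?K" "\<tau> \<inter> \<rho> = {}" by (auto simp: A_def)
    have "x \<le> z \<and> z \<le> y" if z: "z \<in> \<tau>" for z
    proof (rule ccontr)
      assume not: "\<not> (x \<le> z \<and> z \<le> y)"
      have comp: "z \<le> w \<or> w \<le> z" if "w \<in> \<sigma>" for w
        using \<tau>(2) z that by (auto simp: order_complex_iff)
      have "z < x \<or> y < z"
        using not comp[of x] comp[of y] by (auto simp: \<sigma>_def less_le)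
      \<comment> \<open>By maximality it suffices that \<open>z\<close> is comparable with all of
        \<open>C\<close>: with \<open>\<sigma>\<close> because
        \<open>\<tau> \<union> \<sigma>\<close> is a chain, and with the elements between
        \<open>x\<close> and \<open>y\<close> because \<open>z\<close> lies below \<open>x\<close>
        or above \<open>y\<close>.\<close>
      moreover have "z \<in> C"
      proof (rule maxchain_insert[OF C(1)])
        show "z \<in> P" using \<tau>(1) z by (auto simp: order_complex_iff)
        fix u assume u: "u \<in> C"
        show "u \<le> z \<or> z \<le> u"
        proof (cases "u \<in> \<sigma>")
          case True then show ?thesis using comp by blast
        next
          case False
          then have "\<not> u < x" "\<not> y < u" using u by (auto simp: \<sigma>_def \<rho>_def)
          then have "x \<le> u" "u \<le> y" using CD(4)[OF u C(2)] CD(4)[OF u C(3)] by (auto simp: less_le)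
          then show ?thesis
            using \<open>z < x \<or> y < z\<close> by (meson less_imp_le order_trans)
        qed
      qed
      ultimately have "z \<in> \<rho>" by (simp add: \<rho>_def)
      then show False using \<tau>(3) z by blast
    qed
    then show "\<tau> \<in> {C \<in> ?K. \<forall>z\<in>C. x \<le> z \<and> z \<le> y}" using \<tau> by blast
  next
    fix \<tau> assume "\<tau> \<in> {C \<in> ?K. \<forall>z\<in>C. x \<le> z \<and> z \<le> y}"
    then have \<tau>: "\<tau> \<in> ?K" "\<And>z. z \<in> \<tau> \<Longrightarrow> x \<le> z \<and> z \<le> y" by auto
    have "v \<le> w \<or> w \<le> v" if "v \<in> \<tau>" "w \<in> \<sigma>" for v w
    proof -
      have "w \<le> x \<or> y \<le> w" using that(2) by (auto simp: \<sigma>_def \<rho>_def)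
      then show ?thesis using \<tau>(2)[OF that(1)] by (meson order_trans)
    qed
    then have "\<tau> \<union> \<sigma> \<in> ?K"
      using \<tau>(1) \<sigma> unfolding order_complex_iff by blast
    moreover have "\<tau> \<inter> \<rho> = {}" using \<tau>(2) unfolding \<rho>_def by (blast dest: leD)
    ultimately show "\<tau> \<in> {\<tau> \<in> A. \<tau> \<inter> \<rho> = {}}" using \<tau>(1) by (simp add: A_def)
  qed
  moreover have "int (card \<rho>) = int m - length_of (x, y)"
    unfolding \<rho>_def by (rule card_maxchain_outside[OF C xy'])
  ultimately have 3: "pair_homology j A (delete_star A \<sigma>)
    \<cong> pair_homology (j - (int m - length_of (x, y))) (interval_complex P (intervals_within P x y))
        (interval_complex P (intervals_within P x y - {(x, y)}))" for j
    using 2[of j] by (simp only: delete_star_interval_complex[OF maximal_interval_intervals_within[OF xy]])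
  have "pair_homology i (interval_complex P (intervals_within P x y))
        (interval_complex P (intervals_within P x y - {(x, y)}))
      \<cong> pair_homology (i + int m - length_of (x, y)) ?K (delete_star ?K \<sigma>)" for i
  proof -
    \<comment> \<open>The degree is chosen so that the shift in \<open>3\<close> cancels.\<close>
    have e: "i + int m - length_of (x, y) - (int m - length_of (x, y)) = i" by simp
    note h = 3[of "i + int m - length_of (x, y)", unfolded e]
    show ?thesis
      using iso_trans[OF group.iso_sym[OF group_pair_homology h] 1] .
  qed
  then show thesis using that \<sigma> by blast
qed

end

locale manifold_poset = graded_poset +
  fixes n :: nat
  assumes manifold: "homology_manifold n (geometric_realization (order_complex P))"
begin

text \<open>The complex of \<open>[x, x]\<close> is a point, with homology in degree 0 only. Up to a
  shift by \<open>m\<close> it is a local homology group, nonzero in degree \<open>n\<close>, which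
  forces \<open>n - m = 0\<close>.\<close>

lemma dimension_eq_rank: "m = n"
proof -
  obtain C where C: "pred_on.maxchain P (\<le>) C" by (rule ex_maxchain)
  have "C \<noteq> {}" using maxchainD(3)[OF C] by auto
  then obtain x where x: "x \<in> P" using maxchainD(1)[OF C] by blast
  then have xx: "(x, x) \<in> intervals P" by (simp add: intervals_def)
  have w: "intervals_within P x x = {(x, x)}"
    using x by (auto simp: intervals_within_def intervals_def)
  have ic: "interval_complex P {(x, x)} = {{x}}"
    using x by (auto simp: interval_complex_def order_complex_iff)
  obtain \<sigma> where \<sigma>: "\<sigma> \<in> order_complex P"
    "\<And>i. pair_homology i {{x}} {} \<cong> pair_homology (i + int m) (order_complex P) (delete_star (order_complex P) \<sigma>)"
    using interval_homology_iso_star[OF xx] by (auto simp: w ic length_of_def)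
  have "pair_homology (int n - int m) {{x}} {} \<cong> integer_group"
    using iso_trans[OF \<sigma>(2)[of "int n - int m"]]
      homology_manifold_star(2)[OF simplicial_complex_order_complex manifold \<sigma>(1)] by simp
  then have nontriv: "\<not> trivial_group (pair_homology (int n - int m) {{x}} {})"
    by (rule nontrivial_group_of_iso_integers)
  have "int n - int m = 0"
  proof (rule ccontr)
    assume "int n - int m \<noteq> 0"
    from pair_homology_singleton(1)[OF this, of x] nontriv show False by simp
  qed
  then show "m = n" by simp
qed

text \<open>Attaching a maximal interval looks like attaching a cell. Excision reduces to the
  principal ideal, and since \<open>m = n\<close> the shifted degree is \<open>n\<close> exactly
  when \<open>i\<close> is the length.\<close>

lemma interval_pair_homology:
  assumes Q: "interval_ideal P Q" "maximal_interval Q x y"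
  shows "i \<noteq> length_of (x, y) \<Longrightarrow>
      trivial_group (pair_homology i (interval_complex P Q) (interval_complex P (Q - {(x, y)})))"
    and "i = length_of (x, y) \<Longrightarrow>
      pair_homology i (interval_complex P Q) (interval_complex P (Q - {(x, y)})) \<cong> integer_group"
proof -
  have "(x, y) \<in> Q" using Q(2) by (simp add: maximal_interval_def)
  then have xy: "(x, y) \<in> intervals P" "(x, y) \<in> intervals_within P x y"
    using Q(1) by (auto simp: interval_ideal_def intervals_within_def)
  obtain \<sigma> where \<sigma>: "\<sigma> \<in> order_complex P"
    "pair_homology i (interval_complex P (intervals_within P x y))
        (interval_complex P (intervals_within P x y - {(x, y)}))
      \<cong> pair_homology (i + int m - length_of (x, y)) (order_complex P) (delete_star (order_complex P) \<sigma>)"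
    using interval_homology_iso_star[OF xy(1)] by blast
  have "pair_homology i (interval_complex P (intervals_within P x y))
        (interval_complex P (intervals_within P x y - {(x, y)}))
      \<cong> pair_homology i (interval_complex P Q) (interval_complex P (Q - {(x, y)}))"
    using interval_complex_excision[OF Q(1) interval_ideal_intervals_within
       intervals_within_subset[OF Q(1) \<open>(x, y) \<in> Q\<close>] Q(2) xy(2)]
    unfolding is_iso_def by blast
  from iso_trans[OF group.iso_sym[OF group_pair_homology this] \<sigma>(2)]
  have iso: "pair_homology i (interval_complex P Q) (interval_complex P (Q - {(x, y)}))
    \<cong> pair_homology (i + int m - length_of (x, y)) (order_complex P) (delete_star (order_complex P) \<sigma>)" .
  note loc = homology_manifold_star[OF simplicial_complex_order_complex manifold \<sigma>(1), of "i + int m - length_of (x, y)"]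
  show "i \<noteq> length_of (x, y) \<Longrightarrow>
      trivial_group (pair_homology i (interval_complex P Q) (interval_complex P (Q - {(x, y)})))"
    using loc(1) isomorphic_group_triviality[OF iso group_pair_homology group_pair_homology] dimension_eq_rank by simp
  show "i = length_of (x, y) \<Longrightarrow>
      pair_homology i (interval_complex P Q) (interval_complex P (Q - {(x, y)})) \<cong> integer_group"
    using iso_trans[OF iso loc(2)] dimension_eq_rank by simp
qed

end

section \<open>Filtrations by interval ideals\<close>

text \<open>Lets a boundary relative to \<open>M\<close> be computed from an absolute class in
  \<open>L\<close>.\<close>

lemma triple_boundary_eq_pair_map:
  assumes "L \<subseteq> K"
  shows "triple_boundary i K L M c = pair_map (i - 1) L {} L M (triple_boundary i K L {} c)"
  using hom_relboundary_empty[of i "geometric_realization K" "realization_points L"]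
  by (simp add: triple_boundary_def hom_relboundary_def pair_map_def
      subtopology_geometric_realization[OF assms])

lemma pair_homology_empty: "trivial_group (pair_homology i {} {})"
  by (simp add: pair_homology_def geometric_realization_eq trivial_homology_group_empty)

lemma pair_map_iso_of_trivial_relative:
  assumes "L \<subseteq> K" "M \<subseteq> L" "trivial_group (pair_homology i K L)" "trivial_group (pair_homology (i + 1) K L)"
  shows "pair_map i L M K M \<in> iso (pair_homology i L M) (pair_homology i K M)"
proof (rule iso_of_exact)
  show "kernel (pair_homology i L M) (pair_homology i K M) (pair_map i L M K M) \<subseteq> {\<one>\<^bsub>pair_homology i L M\<^esub>}"
    using assms(4) hom_one[OF triple_boundary_hom[OF assms(1), of "i + 1" M]]
    by (simp add: triple_exact_sub[OF assms(1,2)] trivial_group_def)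
  have "pair_map i K M K L x = \<one>\<^bsub>pair_homology i K L\<^esub>" for x
    using pair_map_carrier[of i K M K L x] assms(3) by (simp add: trivial_group_def)
  then show "carrier (pair_homology i K M) \<subseteq> pair_map i L M K M ` carrier (pair_homology i L M)"
    using triple_exact_mid[OF assms(1,2), of i] unfolding kernel_def by blast
qed (simp_all add: pair_map_hom)

lemma int_pow_eq_one_integer_group:
  assumes "group G" "G \<cong> integer_group" "x \<in> carrier G" "x \<noteq> \<one>\<^bsub>G\<^esub>" "x [^]\<^bsub>G\<^esub> (c::int) = \<one>\<^bsub>G\<^esub>"
  shows "c = 0"
proof -
  interpret group G by fact
  obtain h where h: "h \<in> hom G integer_group" "inj_on h (carrier G)"
    using assms(2) by (auto simp: is_iso_def iso_def bij_betw_def)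
  have h1: "h \<one>\<^bsub>G\<^esub> = 0" using hom_one[OF h(1)] by simp
  have "h x \<noteq> 0"
    using inj_onD[OF h(2), of x "\<one>\<^bsub>G\<^esub>"] assms(3,4) h1 by auto
  moreover have "c * h x = 0"
    using hom_int_pow[OF h(1) assms(3), of c] assms(5) h1 by simp
  ultimately show "c = 0" by simp
qed

context graded_poset
begin

abbreviation ideal_homology :: "int \<Rightarrow> ('a \<times> 'a) set \<Rightarrow> ('a \<times> 'a) set \<Rightarrow> ('a \<Rightarrow> real) chain set monoid"
  where "ideal_homology i Q R \<equiv> pair_homology i (interval_complex P Q) (interval_complex P R)"

abbreviation ideal_map :: "int \<Rightarrow> ('a \<times> 'a) set \<Rightarrow> ('a \<times> 'a) set \<Rightarrow> ('a \<times> 'a) set \<Rightarrow> ('a \<times> 'a) set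
    \<Rightarrow> ('a \<Rightarrow> real) chain set \<Rightarrow> ('a \<Rightarrow> real) chain set"
  where "ideal_map i Q R Q' R' \<equiv>
    pair_map i (interval_complex P Q) (interval_complex P R) (interval_complex P Q') (interval_complex P R')"

lemma ideal_map_compose:
  assumes "Q \<subseteq> Q'" "R \<subseteq> R'" "Q' \<subseteq> Q''" "R' \<subseteq> R''"
  shows "ideal_map i Q' R' Q'' R'' (ideal_map i Q R Q' R' c) = ideal_map i Q R Q'' R'' c"
  by (intro pair_map_compose interval_complex_mono assms)

lemma finite_intervals: "finite (intervals P)"
  using finite_P finite_subset[of "intervals P" "P \<times> P"] by (auto simp: intervals_def)

lemma rank_mono: "x \<in> P \<Longrightarrow> y \<in> P \<Longrightarrow> x \<le> y \<Longrightarrow> r x \<le> r y"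
  using rank_strict_mono[of x y] by (cases "x = y") (auto simp: less_le)

lemma rank_eqD: "x \<in> P \<Longrightarrow> y \<in> P \<Longrightarrow> x \<le> y \<Longrightarrow> r y \<le> r x \<Longrightarrow> x = y"
  using rank_strict_mono[of x y] by (cases "x = y") (auto simp: less_le)

lemma length_of_mono:
  assumes "(a, b) \<in> intervals P" "(x, y) \<in> intervals P" "a \<le> x" "y \<le> b"
  shows "length_of (x, y) \<le> length_of (a, b)"
    and "length_of (a, b) \<le> length_of (x, y) \<Longrightarrow> a = x \<and> b = y"
proof -
  have P: "a \<in> P" "b \<in> P" "x \<in> P" "y \<in> P" using assms by (auto simp: intervals_def)
  have le: "r a \<le> r x" "r y \<le> r b" using rank_mono P assms by blast+
  then show "length_of (x, y) \<le> length_of (a, b)" by (simp add: length_of_def)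
  assume "length_of (a, b) \<le> length_of (x, y)"
  then have "r x \<le> r a" "r b \<le> r y" using le by (auto simp: length_of_def)
  then show "a = x \<and> b = y" using rank_eqD P assms by blast
qed

lemma maximal_interval_of_length:
  assumes Q: "interval_ideal P Q" and xy: "(x, y) \<in> Q"
    and len: "\<And>a b. (a, b) \<in> Q \<Longrightarrow> a \<le> x \<Longrightarrow> y \<le> b \<Longrightarrow> length_of (a, b) \<le> length_of (x, y)"
  shows "maximal_interval Q x y"
  unfolding maximal_interval_def
proof (intro conjI allI impI)
  fix a b assume ab: "(a, b) \<in> Q \<and> a \<le> x \<and> y \<le> b"
  have "(a, b) \<in> intervals P" "(x, y) \<in> intervals P"
    using Q xy ab unfolding interval_ideal_def by blast+
  from length_of_mono(2)[OF this] ab len show "a = x" "b = y" by blast+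
qed (rule xy)

text \<open>A longest interval of \<open>Q - Q'\<close> is maximal even in \<open>Q\<close>, because
  intervals of \<open>Q\<close> around it are also outside the ideal \<open>Q'\<close>.\<close>

lemma ex_maximal_interval:
  assumes Q: "interval_ideal P Q" and Q': "interval_ideal P Q'" and ne: "\<not> Q \<subseteq> Q'"
  obtains x y where "maximal_interval Q x y" "(x, y) \<notin> Q'"
proof -
  have fin: "finite (Q - Q')"
    using Q finite_intervals finite_subset unfolding interval_ideal_def by blast
  obtain p where p: "p \<in> Q - Q'" "\<And>q. q \<in> Q - Q' \<Longrightarrow> length_of q \<le> length_of p"
    using obtains_MAX[OF fin, of length_of] ne by (metis Diff_eq_empty_iff Max_ge fin finite_imageI imageI)
  obtain x y where xy: "p = (x, y)" by force
  have "maximal_interval Q x y"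
  proof (rule maximal_interval_of_length[OF Q])
    show "(x, y) \<in> Q" using p xy by blast
    fix a b assume ab: "(a, b) \<in> Q" "a \<le> x" "y \<le> b"
    have "(x, y) \<in> intervals P" using Q p xy unfolding interval_ideal_def by blast
    then have "(a, b) \<notin> Q'" using Q' p(1) xy ab unfolding interval_ideal_def by blast
    then show "length_of (a, b) \<le> length_of (x, y)" using p(2)[of "(a, b)"] ab xy by blast
  qed
  then show thesis using that p xy by blast
qed

text \<open>Cell-by-cell construction of \<open>Q\<close> from \<open>Q'\<close>, by induction on
  the number of intervals outside \<open>Q'\<close>.\<close>

lemma interval_ideal_induct:
  assumes Q: "interval_ideal P Q" "interval_ideal P Q'" "Q' \<subseteq> Q"
    and base: "R Q'"
    and step: "\<And>S x y. interval_ideal P S \<Longrightarrow> Q' \<subseteq> S \<Longrightarrow> S \<subseteq> Q \<Longrightarrow> maximal_interval S x y \<Longrightarrow>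
      (x, y) \<notin> Q' \<Longrightarrow> interval_ideal P (S - {(x, y)}) \<Longrightarrow> R (S - {(x, y)}) \<Longrightarrow> R S"
  shows "R Q"
proof -
  have "R S" if "interval_ideal P S" "Q' \<subseteq> S" "S \<subseteq> Q" for S
    using that
  proof (induction "card (S - Q')" arbitrary: S rule: less_induct)
    case less
    show ?case
    proof (cases "S \<subseteq> Q'")
      case True then show ?thesis using base less.prems by (metis subset_antisym)
    next
      case False
      then obtain x y where xy: "maximal_interval S x y" "(x, y) \<notin> Q'"
        using ex_maximal_interval[OF less.prems(1) Q(2)] by blast
      have S': "interval_ideal P (S - {(x, y)})"
        by (rule interval_ideal_remove_maximal[OF less.prems(1) xy(1)])
      have "finite S"
        using less.prems(1) finite_intervals finite_subset unfolding interval_ideal_def by blast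
      moreover have "S - {(x, y)} - Q' \<subset> S - Q'"
        using xy unfolding maximal_interval_def by blast
      ultimately have "card (S - {(x, y)} - Q') < card (S - Q')"
        by (intro psubset_card_mono) auto
      then have "R (S - {(x, y)})"
        using less.prems xy S' by (intro less.hyps) auto
      then show ?thesis using step less.prems xy S' by blast
    qed
  qed
  then show ?thesis using Q by blast
qed

text \<open>The same filtration run downwards: the induction is applied to the predicate that
  \<open>R S\<close> implies \<open>R Q'\<close>.\<close>

lemma interval_ideal_descend:
  assumes Q: "interval_ideal P Q" "interval_ideal P Q'" "Q' \<subseteq> Q"
    and base: "R Q"
    and step: "\<And>S x y. interval_ideal P S \<Longrightarrow> Q' \<subseteq> S \<Longrightarrow> S \<subseteq> Q \<Longrightarrow> maximal_interval S x y \<Longrightarrow>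
      (x, y) \<notin> Q' \<Longrightarrow> R S \<Longrightarrow> R (S - {(x, y)})"
  shows "R Q'"
  using interval_ideal_induct[OF Q, of "\<lambda>S. R S \<longrightarrow> R Q'"] base step by blast

text \<open>The cells of the \<open>k\<close>-skeleton.\<close>

definition short_intervals :: "nat \<Rightarrow> ('a \<times> 'a) set"
  where "short_intervals k = {p \<in> intervals P. length_of p \<le> int k}"

lemma interval_ideal_short: "interval_ideal P (short_intervals k)"
  unfolding interval_ideal_def
proof (intro conjI allI impI)
  fix a b a' b'
  assume h: "(a, b) \<in> short_intervals k \<and> (a', b') \<in> intervals P \<and> a \<le> a' \<and> b' \<le> b"
  then have "length_of (a', b') \<le> length_of (a, b)"
    using length_of_mono(1) unfolding short_intervals_def by blast
  then show "(a', b') \<in> short_intervals k" using h by (simp add: short_intervals_def)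
qed (auto simp: short_intervals_def)

lemma rank_order_complex_eq: "rank_order_complex P r k = interval_complex P (short_intervals k)"
proof -
  have "(a, b) \<in> short_intervals k \<longleftrightarrow> int (r b) - int (r a) \<le> int k"
    if "C \<in> order_complex P" "a \<in> C" "b \<in> C" "\<forall>z\<in>C. a \<le> z \<and> z \<le> b" for C a b
    using that by (auto simp: short_intervals_def length_of_def intervals_def order_complex_iff)
  then show ?thesis
    unfolding rank_order_complex_def interval_complex_def by blast
qed

end

context manifold_poset
begin

text \<open>Attaching a cell of dimension above \<open>i + 1\<close> does not change homology in
  degree \<open>i\<close>, as its relative homology vanishes in degrees \<open>i\<close> and
  \<open>i + 1\<close>.\<close>

lemma ideal_homology_iso:
  assumes Q: "interval_ideal P Q" "interval_ideal P Q'" "Q' \<subseteq> Q"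
    and len: "\<And>p. p \<in> Q \<Longrightarrow> p \<notin> Q' \<Longrightarrow> i + 1 < length_of p"
  shows "ideal_homology i Q' {} \<cong> ideal_homology i Q {}"
proof (rule interval_ideal_induct[OF Q])
  show "ideal_homology i Q' {} \<cong> ideal_homology i Q' {}" by (rule iso_refl)
  fix S x y
  assume S: "interval_ideal P S" "Q' \<subseteq> S" "S \<subseteq> Q" "maximal_interval S x y" "(x, y) \<notin> Q'"
    and IH: "ideal_homology i Q' {} \<cong> ideal_homology i (S - {(x, y)}) {}"
  have "(x, y) \<in> Q" using S by (auto simp: maximal_interval_def)
  then have "i + 1 < length_of (x, y)" using len S(5) by blast
  then have "trivial_group (ideal_homology i S (S - {(x, y)}))"
    "trivial_group (ideal_homology (i + 1) S (S - {(x, y)}))"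
    by (auto intro!: interval_pair_homology(1)[OF S(1,4)])
  then have "ideal_homology i (S - {(x, y)}) {} \<cong> ideal_homology i S {}"
    using pair_map_iso_of_trivial_relative[of "interval_complex P (S - {(x, y)})" "interval_complex P S" "interval_complex P {}" i]
    by (auto simp: is_iso_def interval_complex_mono)
  then show "ideal_homology i Q' {} \<cong> ideal_homology i S {}" using IH iso_trans by blast
qed

text \<open>Follows the family down the filtration. Below a cell of dimension other than
  \<open>i\<close> the whole family lifts; for a cell of dimension \<open>i\<close> the relative
  group is infinite cyclic, and at most one member is lost.\<close>

lemma card_independent_family_le:
  fixes v :: "'i \<Rightarrow> ('a \<Rightarrow> real) chain set"
  assumes Q: "interval_ideal P Q" and "independent_family (ideal_homology i Q {}) I v"
  shows "card I \<le> card {p \<in> Q. length_of p = i}"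
proof -
  \<comment> \<open>Index set and family are quantified inside, since both may change when a cell is
    removed.\<close>
  have "\<forall>(I :: 'i set) v. independent_family (ideal_homology i Q {}) I v \<longrightarrow> card I \<le> card {p \<in> Q. length_of p = i}"
  proof (rule interval_ideal_induct[OF Q, of "{}"])
    show "interval_ideal P {}" by (simp add: interval_ideal_def)
    show "\<forall>(I :: 'i set) v. independent_family (ideal_homology i {} {}) I v \<longrightarrow> card I \<le> card {p \<in> {}. length_of p = i}"
      using independent_family_trivial_group[OF comm_group_pair_homology pair_homology_empty] by fastforce
    fix S x y
    assume S: "interval_ideal P S" "maximal_interval S x y"
      and IH: "\<forall>(I :: 'i set) v. independent_family (ideal_homology i (S - {(x, y)}) {}) I v
        \<longrightarrow> card I \<le> card {p \<in> S - {(x, y)}. length_of p = i}"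
    let ?S' = "S - {(x, y)}"
    let ?f = "ideal_map i ?S' {} S {}" and ?g = "ideal_map i S {} S ?S'"
    have ker: "kernel (ideal_homology i S {}) (ideal_homology i S ?S') ?g = ?f ` carrier (ideal_homology i ?S' {})"
      by (intro triple_exact_mid interval_complex_mono) auto
    have finS: "finite S"
      using S(1) finite_intervals finite_subset unfolding interval_ideal_def by blast
    show "\<forall>(I :: 'i set) v. independent_family (ideal_homology i S {}) I v \<longrightarrow> card I \<le> card {p \<in> S. length_of p = i}"
    proof (intro allI impI)
      fix I :: "'i set" and v
      assume I: "independent_family (ideal_homology i S {}) I v"
      have vI: "v j \<in> carrier (ideal_homology i S {})" if "j \<in> I" for j
        using I that by (auto simp: independent_family_def)
      show "card I \<le> card {p \<in> S. length_of p = i}"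
      proof (cases "i = length_of (x, y)")
        case False
        then have "trivial_group (ideal_homology i S ?S')"
          using interval_pair_homology(1)[OF S] by blast
        then have "carrier (ideal_homology i S ?S') = {\<one>\<^bsub>ideal_homology i S ?S'\<^esub>}"
          by (simp add: trivial_group_def)
        moreover have "?g (v j) \<in> carrier (ideal_homology i S ?S')" for j
          by (rule pair_map_carrier)
        \<comment> \<open>By exactness, classes that die in the relative group come from
          \<open>?S'\<close>.\<close>
        ultimately have "v ` I \<subseteq> ?f ` carrier (ideal_homology i ?S' {})"
          unfolding ker[symmetric] kernel_def using vI by blast
        then obtain a where "independent_family (ideal_homology i ?S' {}) I a"
          using independent_family_lift[OF comm_group_pair_homology comm_group_pair_homology pair_map_hom I] by blast
        then have "card I \<le> card {p \<in> ?S'. length_of p = i}" using IH by blast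
        also have "\<dots> \<le> card {p \<in> S. length_of p = i}"
          using finS by (intro card_mono) auto
        finally show ?thesis .
      next
        case True
        then obtain h where h: "h \<in> hom (ideal_homology i S ?S') integer_group"
            "inj_on h (carrier (ideal_homology i S ?S'))"
          using interval_pair_homology(2)[OF S True] by (auto simp: is_iso_def iso_def bij_betw_def)
        have hg: "h \<circ> ?g \<in> hom (ideal_homology i S {}) integer_group"
          by (rule hom_compose[OF pair_map_hom h(1)])
        obtain J w where J: "J \<subseteq> I" "card I \<le> card J + 1"
            "independent_family (ideal_homology i S {}) J w" "\<And>j. j \<in> J \<Longrightarrow> (h \<circ> ?g) (w j) = 0"
          using independent_family_to_integers[OF comm_group_pair_homology hg I] by blast
        have one: "h \<one>\<^bsub>ideal_homology i S ?S'\<^esub> = 0"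
          using hom_one[OF h(1)] by simp
        have "?g (w j) = \<one>\<^bsub>ideal_homology i S ?S'\<^esub>" if "j \<in> J" for j
        proof (rule inj_onD[OF h(2)])
          show "h (?g (w j)) = h \<one>\<^bsub>ideal_homology i S ?S'\<^esub>" using J(4)[OF that] one by simp
        qed (simp_all add: pair_map_carrier monoid.one_closed group.is_monoid)
        moreover have "w j \<in> carrier (ideal_homology i S {})" if "j \<in> J" for j
          using J(3) that by (auto simp: independent_family_def)
        ultimately have "w ` J \<subseteq> ?f ` carrier (ideal_homology i ?S' {})"
          unfolding ker[symmetric] kernel_def by blast
        then obtain a where "independent_family (ideal_homology i ?S' {}) J a"
          using independent_family_lift[OF comm_group_pair_homology comm_group_pair_homology pair_map_hom J(3)] by blast
        then have "card J \<le> card {p \<in> ?S'. length_of p = i}" using IH by blast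
        moreover have "{p \<in> S. length_of p = i} = insert (x, y) {p \<in> ?S'. length_of p = i}"
          using True S(2) by (auto simp: maximal_interval_def)
        ultimately show ?thesis using J(2) finS by simp
      qed
    qed
  qed simp
  then show ?thesis using assms(2) by blast
qed

end

section \<open>Independent classes\<close>

text \<open>The intervals inside the half-open interval \<open>(x, y]\<close>; their complex
  consists of the chains in \<open>[x, y]\<close> that avoid \<open>x\<close>.\<close>

definition intervals_above :: "'a::order set \<Rightarrow> 'a \<Rightarrow> 'a \<Rightarrow> ('a \<times> 'a) set"
  where "intervals_above P x y = {(a, b) \<in> intervals P. x < a \<and> b \<le> y}"

lemma interval_ideal_intervals_above: "interval_ideal P (intervals_above P x y)"
  unfolding interval_ideal_def intervals_above_def by (auto intro: order_trans less_le_trans)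

lemma interval_complex_intervals_above:
  "interval_complex P (intervals_above P x y) = {C \<in> order_complex P. \<forall>z\<in>C. x < z \<and> z \<le> y}"
proof (intro equalityI subsetI)
  fix C assume "C \<in> interval_complex P (intervals_above P x y)"
  then obtain a b where "C \<in> order_complex P" "\<forall>z\<in>C. a \<le> z \<and> z \<le> b" "x < a" "b \<le> y"
    unfolding interval_complex_def intervals_above_def by blast
  then show "C \<in> {C \<in> order_complex P. \<forall>z\<in>C. x < z \<and> z \<le> y}"
    by (blast intro: order_trans less_le_trans)
next
  fix C assume C: "C \<in> {C \<in> order_complex P. \<forall>z\<in>C. x < z \<and> z \<le> y}"
  then have "C \<in> interval_complex P (intervals P)" by (simp add: interval_complex_intervals)
  then obtain a b where "a \<in> C" "b \<in> C" "\<forall>z\<in>C. a \<le> z \<and> z \<le> b" "(a, b) \<in> intervals P"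
    unfolding interval_complex_def by blast
  then have "\<exists>a\<in>C. \<exists>b\<in>C. (\<forall>z\<in>C. a \<le> z \<and> z \<le> b) \<and> (a, b) \<in> intervals_above P x y"
    using C unfolding intervals_above_def by blast
  then show "C \<in> interval_complex P (intervals_above P x y)"
    using C unfolding interval_complex_def by blast
qed

lemma insert_top_order_complex:
  assumes "C \<in> order_complex P" "y \<in> P" "\<And>z. z \<in> C \<Longrightarrow> z \<le> y"
  shows "insert y C \<in> order_complex P"
  using assms unfolding order_complex_iff by blast

text \<open>Both complexes are cones with apex \<open>y\<close>, which lies in the smaller one
  because \<open>x < y\<close>.\<close>

lemma trivial_homology_intervals_within_above:
  assumes "x \<in> P" "y \<in> P" "x < y"
  shows "trivial_group (pair_homology i (interval_complex P (intervals_within P x y))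
    (interval_complex P (intervals_above P x y)))"
proof (rule trivial_pair_homology_cone[where v = y])
  show "interval_complex P (intervals_above P x y) \<subseteq> interval_complex P (intervals_within P x y)"
    by (rule interval_complex_mono) (auto simp: intervals_above_def intervals_within_def)
  show "{y} \<in> interval_complex P (intervals_above P x y)"
    using assms by (simp add: interval_complex_intervals_above order_complex_iff)
  show "insert y C \<in> interval_complex P (intervals_within P x y)"
    if "C \<in> interval_complex P (intervals_within P x y)" for C
    using that assms insert_top_order_complex[of C P y]
    unfolding interval_complex_intervals_within by (auto simp: less_imp_le)
  show "insert y C \<in> interval_complex P (intervals_above P x y)"
    if "C \<in> interval_complex P (intervals_above P x y)" for C
    using that assms insert_top_order_complex[of C P y]
    unfolding interval_complex_intervals_above by auto
qed (intro simplicial_complex_interval_complex interval_ideal_intervals_within interval_ideal_intervals_above)+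

context manifold_poset
begin

text \<open>\<open>z\<close> is the boundary of a nonzero class \<open>g\<close> of the cell
  \<open>[x, y]\<close> and stays nonzero relative to \<open>T\<close>. If it vanished on every
  \<open>k\<close>-cell \<open>[x, w]\<close>, removing the cells that start at \<open>x\<close> one
  by one would push it into \<open>T\<close>.\<close>

lemma interval_boundary_class:
  assumes xy: "(x, y) \<in> intervals P" "length_of (x, y) = int k + 1"
  defines "S \<equiv> intervals_within P x y - {(x, y)}"
  obtains w z where "(x, w) \<in> S" "length_of (x, w) = int k"
    "z \<in> carrier (ideal_homology (int k) S {})"
    "ideal_map (int k) S {} S (S - {(x, w)}) z \<noteq> \<one>\<^bsub>ideal_homology (int k) S (S - {(x, w)})\<^esub>"
proof -
  define I where "I = intervals_within P x y"
  define T where "T = intervals_above P x y"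
  have P: "x \<in> P" "y \<in> P" "x \<le> y" using xy(1) by (auto simp: intervals_def)
  have "x \<noteq> y" using xy(2) by (auto simp: length_of_def)
  then have lt: "x < y" using P by simp
  have I: "interval_ideal P I" "maximal_interval I x y"
    unfolding I_def by (rule interval_ideal_intervals_within, rule maximal_interval_intervals_within[OF xy(1)])
  have SI: "S = I - {(x, y)}" by (simp add: S_def I_def)
  have S: "interval_ideal P S" unfolding SI by (rule interval_ideal_remove_maximal[OF I])
  have T: "interval_ideal P T" unfolding T_def by (rule interval_ideal_intervals_above)
  have TS: "T \<subseteq> S" by (auto simp: T_def S_def intervals_above_def intervals_within_def)
  have cS: "interval_complex P S \<subseteq> interval_complex P I" by (rule interval_complex_mono) (auto simp: SI)
  have cT: "interval_complex P T \<subseteq> interval_complex P S" by (rule interval_complex_mono[OF TS])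
  have triv: "trivial_group (ideal_homology i I T)" for i
    unfolding I_def T_def by (rule trivial_homology_intervals_within_above[OF P(1,2) lt])
  let ?d = "\<lambda>M. triple_boundary (int k + 1) (interval_complex P I) (interval_complex P S) M"
  have "ideal_homology (int k + 1) I S \<cong> integer_group"
    unfolding SI using interval_pair_homology(2)[OF I] xy(2) by simp
  then have "\<not> trivial_group (ideal_homology (int k + 1) I S)"
    by (rule nontrivial_group_of_iso_integers)
  then have "\<not> carrier (ideal_homology (int k + 1) I S) \<subseteq> {\<one>\<^bsub>ideal_homology (int k + 1) I S\<^esub>}"
    by (simp add: group.trivial_group_subset)
  then obtain g where g: "g \<in> carrier (ideal_homology (int k + 1) I S)" "g \<noteq> \<one>\<^bsub>ideal_homology (int k + 1) I S\<^esub>"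
    by (auto simp: subset_iff)
  define z where "z = ?d {} g"
  have z: "z \<in> carrier (ideal_homology (int k) S {})"
    using hom_in_carrier[OF triple_boundary_hom[OF cS] g(1), of "{}"] by (simp add: z_def)
  \<comment> \<open>\<open>I\<close> relative to \<open>T\<close> has no homology, so the connecting
    map of the triple is an isomorphism.\<close>
  have diso: "?d (interval_complex P T) \<in> iso (ideal_homology (int k + 1) I S) (ideal_homology (int k) S T)"
    using triple_boundary_iso[OF cS cT triv triv, of "int k + 1"] by simp
  have "?d (interval_complex P T) g = ideal_map (int k) S {} S T z"
    using triple_boundary_eq_pair_map[OF cS, of "int k + 1" "interval_complex P T" g] by (simp add: z_def)
  moreover have "?d (interval_complex P T) g \<noteq> \<one>\<^bsub>ideal_homology (int k) S T\<^esub>"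
  proof
    have dh: "?d (interval_complex P T) \<in> hom (ideal_homology (int k + 1) I S) (ideal_homology (int k) S T)"
      and inj: "inj_on (?d (interval_complex P T)) (carrier (ideal_homology (int k + 1) I S))"
      using diso by (auto simp: iso_def bij_betw_def)
    assume "?d (interval_complex P T) g = \<one>\<^bsub>ideal_homology (int k) S T\<^esub>"
    then have "?d (interval_complex P T) g = ?d (interval_complex P T) \<one>\<^bsub>ideal_homology (int k + 1) I S\<^esub>"
      using hom_one[OF dh] by simp
    then have "g = \<one>\<^bsub>ideal_homology (int k + 1) I S\<^esub>"
      using inj_onD[OF inj _ g(1)] by (simp add: monoid.one_closed group.is_monoid)
    then show False using g(2) by simp
  qed
  ultimately have zT: "ideal_map (int k) S {} S T z \<noteq> \<one>\<^bsub>ideal_homology (int k) S T\<^esub>" by simp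
  have "\<exists>w. (x, w) \<in> S \<and> length_of (x, w) = int k \<and>
    ideal_map (int k) S {} S (S - {(x, w)}) z \<noteq> \<one>\<^bsub>ideal_homology (int k) S (S - {(x, w)})\<^esub>"
  proof (rule ccontr)
    assume none: "\<not> ?thesis"
    \<comment> \<open>The intervals of \<open>S - T\<close> are removed one at a time, keeping
      \<open>z\<close> in the image of what is left.\<close>
    have "z \<in> ideal_map (int k) T {} S {} ` carrier (ideal_homology (int k) T {})"
    proof (rule interval_ideal_descend[OF S T TS])
      show "z \<in> ideal_map (int k) S {} S {} ` carrier (ideal_homology (int k) S {})"
        using pair_map_id[OF z[simplified]] z by force
      fix Q a b
      assume Q: "interval_ideal P Q" "T \<subseteq> Q" "Q \<subseteq> S" "maximal_interval Q a b" "(a, b) \<notin> T"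
        and "z \<in> ideal_map (int k) Q {} S {} ` carrier (ideal_homology (int k) Q {})"
      then obtain u where u: "u \<in> carrier (ideal_homology (int k) Q {})" "z = ideal_map (int k) Q {} S {} u"
        by blast
      let ?Q' = "Q - {(a, b)}"
      have abQ: "(a, b) \<in> Q" using Q(4) by (simp add: maximal_interval_def)
      then have abS: "(a, b) \<in> S" using Q(3) by blast
      then have "a = x" using Q(5) by (auto simp: S_def T_def intervals_within_def intervals_above_def less_le)
      let ?c = "ideal_map (int k) Q {} Q ?Q' u"
      have c: "?c \<in> carrier (ideal_homology (int k) Q ?Q')" by (rule pair_map_carrier)
      \<comment> \<open>Only a cell of dimension \<open>k\<close> can obstruct the lift; there
        \<open>none\<close> applies after excision from \<open>Q\<close> to
        \<open>S\<close>.\<close>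
      have "?c = \<one>\<^bsub>ideal_homology (int k) Q ?Q'\<^esub>"
      proof (cases "int k = length_of (a, b)")
        case False
        then show ?thesis using interval_pair_homology(1)[OF Q(1,4) False] c by (simp add: trivial_group_def)
      next
        case True
        \<comment> \<open>All intervals in \<open>S\<close> have length at most \<open>k\<close>, so
          one of length \<open>k\<close> is maximal in \<open>S\<close> and not only in
          \<open>Q\<close>.\<close>
        have mxS: "maximal_interval S a b"
        proof (rule maximal_interval_of_length[OF S abS])
          fix c d assume cd: "(c, d) \<in> S" "c \<le> a" "b \<le> d"
          then have 1: "(c, d) \<in> intervals P" "x \<le> c" "d \<le> y" "(c, d) \<noteq> (x, y)"
            by (auto simp: S_def intervals_within_def)
          have "length_of (c, d) \<le> length_of (x, y)" "length_of (c, d) \<noteq> length_of (x, y)"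
            using length_of_mono[OF xy(1) 1(1-3)] 1(4) by auto
          then show "length_of (c, d) \<le> length_of (a, b)" using True xy(2) by simp
        qed
        have exc: "ideal_map (int k) Q ?Q' S (S - {(a, b)})
          \<in> iso (ideal_homology (int k) Q ?Q') (ideal_homology (int k) S (S - {(a, b)}))"
          by (rule interval_complex_excision[OF S Q(1,3) mxS abQ])
        have eh: "ideal_map (int k) Q ?Q' S (S - {(a, b)})
          \<in> hom (ideal_homology (int k) Q ?Q') (ideal_homology (int k) S (S - {(a, b)}))"
          by (rule pair_map_hom)
        have "ideal_map (int k) Q ?Q' S (S - {(a, b)}) ?c = ideal_map (int k) Q {} S (S - {(a, b)}) u"
          using Q(3) by (intro ideal_map_compose) auto
        also have "\<dots> = ideal_map (int k) S {} S (S - {(a, b)}) (ideal_map (int k) Q {} S {} u)"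
          using Q(3) by (intro ideal_map_compose[symmetric]) auto
        also have "\<dots> = \<one>\<^bsub>ideal_homology (int k) S (S - {(a, b)})\<^esub>"
          using none True abS \<open>a = x\<close> u(2) by force
        also have "\<dots> = ideal_map (int k) Q ?Q' S (S - {(a, b)}) \<one>\<^bsub>ideal_homology (int k) Q ?Q'\<^esub>"
          using hom_one[OF eh] by simp
        finally have eq: "ideal_map (int k) Q ?Q' S (S - {(a, b)}) ?c
          = ideal_map (int k) Q ?Q' S (S - {(a, b)}) \<one>\<^bsub>ideal_homology (int k) Q ?Q'\<^esub>" .
        have inj: "inj_on (ideal_map (int k) Q ?Q' S (S - {(a, b)})) (carrier (ideal_homology (int k) Q ?Q'))"
          using exc by (auto simp: iso_def bij_betw_def)
        show ?thesis
          by (rule inj_onD[OF inj eq c]) (simp add: monoid.one_closed group.is_monoid)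
      qed
      then have "u \<in> kernel (ideal_homology (int k) Q {}) (ideal_homology (int k) Q ?Q') (ideal_map (int k) Q {} Q ?Q')"
        using u(1) by (simp add: kernel_def)
      also have "\<dots> = ideal_map (int k) ?Q' {} Q {} ` carrier (ideal_homology (int k) ?Q' {})"
        by (intro triple_exact_mid interval_complex_mono) auto
      finally obtain u' where u': "u' \<in> carrier (ideal_homology (int k) ?Q' {})" "u = ideal_map (int k) ?Q' {} Q {} u'"
        by blast
      have "z = ideal_map (int k) ?Q' {} S {} u'"
        unfolding u(2) u'(2) using Q(3) by (intro ideal_map_compose) auto
      then show "z \<in> ideal_map (int k) ?Q' {} S {} ` carrier (ideal_homology (int k) ?Q' {})"
        using u'(1) by blast
    qed
    also have "ideal_map (int k) T {} S {} ` carrier (ideal_homology (int k) T {})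
      = kernel (ideal_homology (int k) S {}) (ideal_homology (int k) S T) (ideal_map (int k) S {} S T)"
      by (intro triple_exact_mid[symmetric] interval_complex_mono TS) auto
    finally show False using zT by (simp add: kernel_def)
  qed
  then show thesis using that z by blast
qed

text \<open>The map \<open>?\<phi> i\<close> reads off the cell \<open>[x i, w i]\<close>. Classes
  with index \<open>j > i\<close> are supported above \<open>x j\<close> and do not see this cell,
  so the system is triangular.\<close>

lemma ex_independent_family:
  assumes "k \<le> n"
  obtains z where "independent_family (ideal_homology (int k) (short_intervals k) {}) {..<n - k} z"
proof -
  obtain C where C: "pred_on.maxchain P (\<le>) C" by (rule ex_maxchain)
  note CD = maxchainD[OF C]
  \<comment> \<open>\<open>e j\<close> is the element of rank \<open>j\<close> in the maximal chain;
    it exists for all \<open>j \<le> n\<close> since \<open>m = n\<close>.\<close>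
  define e where "e = inv_into C r"
  have e: "e j \<in> C" "r (e j) = j" if "j \<le> n" for j
    using maxchain_rank_bij[OF C] that unfolding e_def bij_betw_def dimension_eq_rank
    by (metis atMost_iff inv_into_into, metis atMost_iff f_inv_into_f)
  define x where "x = (\<lambda>j. e j)"
  define y where "y = (\<lambda>j. e (j + k + 1))"
  define S where "S = (\<lambda>j. intervals_within P (x j) (y j) - {(x j, y j)})"
  let ?Q = "short_intervals k"
  \<comment> \<open>The bound \<open>j < n - k\<close> is exactly what makes the rank
    \<open>j + k + 1\<close> occur.\<close>
  have xy: "(x j, y j) \<in> intervals P" "length_of (x j, y j) = int k + 1" "r (x j) = j" if "j < n - k" for j
  proof -
    have jn: "j \<le> n" "j + k + 1 \<le> n" using that by auto
    have "x j \<le> y j \<or> y j \<le> x j" using CD(4) e jn by (simp add: x_def y_def)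
    moreover have "\<not> y j \<le> x j"
      using rank_mono[of "y j" "x j"] e[OF jn(1)] e[OF jn(2)] CD(1) by (auto simp: x_def y_def)
    ultimately show "(x j, y j) \<in> intervals P"
      using e[OF jn(1)] e[OF jn(2)] CD(1) by (auto simp: intervals_def x_def y_def)
    show "length_of (x j, y j) = int k + 1" "r (x j) = j"
      using e[OF jn(1)] e[OF jn(2)] by (simp_all add: length_of_def x_def y_def)
  qed
  have "\<exists>w z. (x j, w) \<in> S j \<and> length_of (x j, w) = int k \<and> z \<in> carrier (ideal_homology (int k) (S j) {}) \<and>
    ideal_map (int k) (S j) {} (S j) (S j - {(x j, w)}) z \<noteq> \<one>\<^bsub>ideal_homology (int k) (S j) (S j - {(x j, w)})\<^esub>"
    if "j < n - k" for j
    using interval_boundary_class[OF xy(1,2)[OF that]] unfolding S_def by metis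
  then obtain w z where wz: "\<And>j. j < n - k \<Longrightarrow> (x j, w j) \<in> S j" "\<And>j. j < n - k \<Longrightarrow> length_of (x j, w j) = int k"
    "\<And>j. j < n - k \<Longrightarrow> z j \<in> carrier (ideal_homology (int k) (S j) {})"
    "\<And>j. j < n - k \<Longrightarrow> ideal_map (int k) (S j) {} (S j) (S j - {(x j, w j)}) (z j)
      \<noteq> \<one>\<^bsub>ideal_homology (int k) (S j) (S j - {(x j, w j)})\<^esub>"
    by metis
  have Sid: "interval_ideal P (S j)" if "j < n - k" for j
    unfolding S_def
    by (rule interval_ideal_remove_maximal[OF interval_ideal_intervals_within
        maximal_interval_intervals_within[OF xy(1)[OF that]]])
  \<comment> \<open>Proper subintervals of \<open>[x j, y j]\<close> have length at most
    \<open>k\<close>, so the boundary classes live in the \<open>k\<close>-skeleton.\<close>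
  have SQ: "S j \<subseteq> ?Q" if "j < n - k" for j
  proof
    fix p assume "p \<in> S j"
    moreover obtain a b where p: "p = (a, b)" by force
    ultimately have 1: "(a, b) \<in> intervals P" "x j \<le> a" "b \<le> y j" "(a, b) \<noteq> (x j, y j)"
      by (auto simp: S_def intervals_within_def)
    have "length_of (a, b) \<le> int k + 1" "length_of (a, b) \<noteq> int k + 1"
      using length_of_mono[OF xy(1)[OF that] 1(1-3)] 1(4) xy(2)[OF that] by auto
    then show "p \<in> ?Q" using 1(1) p by (simp add: short_intervals_def)
  qed
  have mx: "maximal_interval ?Q (x j) (w j)" if "j < n - k" for j
    using SQ[OF that] wz(1,2)[OF that] 
    by (intro maximal_interval_of_length[OF interval_ideal_short]) (auto simp: short_intervals_def)
  let ?\<zeta> = "\<lambda>j. ideal_map (int k) (S j) {} ?Q {} (z j)"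
  let ?\<phi> = "\<lambda>j. ideal_map (int k) ?Q {} ?Q (?Q - {(x j, w j)})"
  let ?H = "\<lambda>j. ideal_homology (int k) ?Q (?Q - {(x j, w j)})"
  have "independent_family (ideal_homology (int k) ?Q {}) {..<n - k} ?\<zeta>"
  proof (rule independent_family_triangular[where H = ?H and \<phi> = ?\<phi>])
    fix j and c :: int
    assume j: "j < n - k" and c: "?\<phi> j (?\<zeta> j) [^]\<^bsub>?H j\<^esub> c = \<one>\<^bsub>?H j\<^esub>"
    let ?S' = "S j - {(x j, w j)}"
    let ?e = "ideal_map (int k) (S j) ?S' ?Q (?Q - {(x j, w j)})"
    let ?c = "ideal_map (int k) (S j) {} (S j) ?S' (z j)"
    have exc: "?e \<in> iso (ideal_homology (int k) (S j) ?S') (?H j)"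
      by (rule interval_complex_excision[OF interval_ideal_short Sid[OF j] SQ[OF j] mx[OF j] wz(1)[OF j]])
    then have eh: "?e \<in> hom (ideal_homology (int k) (S j) ?S') (?H j)"
      and inj: "inj_on ?e (carrier (ideal_homology (int k) (S j) ?S'))"
      by (auto simp: iso_def bij_betw_def)
    have e1: "?\<phi> j (?\<zeta> j) = ideal_map (int k) (S j) {} ?Q (?Q - {(x j, w j)}) (z j)"
      using SQ[OF j] by (intro ideal_map_compose) auto
    have e2: "?e ?c = ideal_map (int k) (S j) {} ?Q (?Q - {(x j, w j)}) (z j)"
      using SQ[OF j] by (intro ideal_map_compose) auto
    \<comment> \<open>Excision carries the nonvanishing in \<open>wz(4)\<close> from
      \<open>S j\<close> to \<open>?Q\<close>; in an infinite cyclic group no nonzero multiple of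
      such a class vanishes.\<close>
    have "?\<phi> j (?\<zeta> j) \<noteq> \<one>\<^bsub>?H j\<^esub>"
    proof
      assume "?\<phi> j (?\<zeta> j) = \<one>\<^bsub>?H j\<^esub>"
      then have eq: "?e ?c = ?e \<one>\<^bsub>ideal_homology (int k) (S j) ?S'\<^esub>"
        unfolding e2 using e1 hom_one[OF eh] by simp
      have "?c = \<one>\<^bsub>ideal_homology (int k) (S j) ?S'\<^esub>"
        by (rule inj_onD[OF inj eq pair_map_carrier]) (simp add: monoid.one_closed group.is_monoid)
      then show False using wz(4)[OF j] by simp
    qed
    then show "c = 0"
      using c interval_pair_homology(2)[OF interval_ideal_short mx[OF j]] wz(2)[OF j]
      by (intro int_pow_eq_one_integer_group[of "?H j"]) (simp_all add: pair_map_carrier)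
  next
    fix i j assume ij: "i < j" "j < n - k"
    \<comment> \<open>Intervals in \<open>S j\<close> start at or above \<open>x j\<close>, whose
      rank exceeds that of \<open>x i\<close>.\<close>
    have "(x i, w i) \<notin> S j"
    proof
      assume "(x i, w i) \<in> S j"
      then have "x j \<le> x i" by (auto simp: S_def intervals_within_def)
      moreover have "x i \<in> P" "x j \<in> P" "r (x i) = i" "r (x j) = j"
        using xy(1,3)[of i] xy(1,3)[of j] ij by (auto simp: intervals_def)
      ultimately show False using rank_mono[of "x j" "x i"] ij by simp
    qed
    then have sub: "S j \<subseteq> ?Q - {(x i, w i)}" using SQ[OF ij(2)] by blast
    have "?\<zeta> j = ideal_map (int k) (?Q - {(x i, w i)}) {} ?Q {} (ideal_map (int k) (S j) {} (?Q - {(x i, w i)}) {} (z j))"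
      using sub by (intro ideal_map_compose[symmetric]) auto
    also have "\<dots> \<in> ideal_map (int k) (?Q - {(x i, w i)}) {} ?Q {} ` carrier (ideal_homology (int k) (?Q - {(x i, w i)}) {})"
      by (intro imageI pair_map_carrier)
    also have "\<dots> = kernel (ideal_homology (int k) ?Q {}) (?H i) (?\<phi> i)"
      by (intro triple_exact_mid[symmetric] interval_complex_mono) auto
    finally show "?\<phi> i (?\<zeta> j) = \<one>\<^bsub>?H i\<^esub>" by (simp add: kernel_def)
  qed (simp_all add: pair_map_hom pair_map_carrier)
  then show thesis by (rule that)
qed

end

theorem theorem3p6:
  fixes P :: "'a::order set" and r :: "'a \<Rightarrow> nat" and X :: "'b topology" and m n k :: nat
  assumes "finite_graded_poset P m r"
    and "homology_manifold n X"
    and "geometric_realization (order_complex P) homeomorphic_space X"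
    and "k \<le> n"
  shows "(\<forall>i::int. i \<le> int k - 1 \<longrightarrow>
            homology_group i (geometric_realization (rank_order_complex P r k))
              \<cong> homology_group i X)
       \<and> enat (n - k) \<le> betti_number k (geometric_realization (rank_order_complex P r k))
       \<and> betti_number k (geometric_realization (rank_order_complex P r k))
           \<le> enat (card {(x, y) \<in> P \<times> P. x \<le> y \<and> int (r y) - int (r x) = int k})"
proof -
  \<comment> \<open>The local homology condition is invariant under homeomorphism, so it passes from
    \<open>X\<close> to the realization.\<close>
  interpret manifold_poset P m r n
    using assms(1) homology_manifold_homeomorphic[OF assms(2,3)]
    by (simp add: manifold_poset_def graded_poset_def manifold_poset_axioms_def)
  let ?Q = "short_intervals k"
  have hom: "homology_group i (geometric_realization (rank_order_complex P r k)) = ideal_homology i ?Q {}" for i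
    by (simp add: homology_group_realization rank_order_complex_eq)
  have "ideal_homology i ?Q {} \<cong> homology_group i X" if "i \<le> int k - 1" for i
  proof -
    \<comment> \<open>Every interval outside the \<open>k\<close>-skeleton has length at least
      \<open>k + 1\<close>, hence more than \<open>i + 1\<close>.\<close>
    have "ideal_homology i ?Q {} \<cong> ideal_homology i (intervals P) {}"
      using that
      by (intro ideal_homology_iso interval_ideal_intervals interval_ideal_short)
         (auto simp: short_intervals_def)
    also have "ideal_homology i (intervals P) {} = homology_group i (geometric_realization (order_complex P))"
      by (simp add: homology_group_realization interval_complex_intervals)
    also have "\<dots> \<cong> homology_group i X"
      by (rule homeomorphic_space_imp_isomorphic_homology_groups[OF assms(3)])
    finally show ?thesis .
  qed
  moreover have "enat (n - k) \<le> abelian_group_rank (ideal_homology (int k) ?Q {})"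
  proof -
    obtain z where z: "independent_family (ideal_homology (int k) ?Q {}) {..<n - k} z"
      using ex_independent_family[OF assms(4)] by blast
    note img = independent_family_image[OF comm_group_pair_homology z]
    have "enat (n - k) = enat (card (z ` {..<n - k}))"
      using card_image[OF img(1)] by simp
    also have "\<dots> \<le> abelian_group_rank (ideal_homology (int k) ?Q {})"
      unfolding abelian_group_rank_def using img(2) by (intro SUP_upper) simp
    finally show ?thesis .
  qed
  moreover have "abelian_group_rank (ideal_homology (int k) ?Q {})
    \<le> enat (card {(x, y) \<in> P \<times> P. x \<le> y \<and> int (r y) - int (r x) = int k})"
    unfolding abelian_group_rank_def
  proof (rule SUP_least)
    fix B assume "B \<in> {B. independent_in (ideal_homology (int k) ?Q {}) B}"
    then have "independent_family (ideal_homology (int k) ?Q {}) B (\<lambda>b. b)"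
      by (simp add: independent_in_iff_family)
    from card_independent_family_le[OF interval_ideal_short this]
    have "card B \<le> card {p \<in> ?Q. length_of p = int k}" .
    also have "{p \<in> ?Q. length_of p = int k} = {(x, y) \<in> P \<times> P. x \<le> y \<and> int (r y) - int (r x) = int k}"
      by (auto simp: short_intervals_def intervals_def length_of_def)
    finally show "enat (card B) \<le> enat (card {(x, y) \<in> P \<times> P. x \<le> y \<and> int (r y) - int (r x) = int k})"
      by simp
  qed
  ultimately show ?thesis unfolding betti_number_def hom by blast
qed

end
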